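(* Let $\mathcal{M}_{\mathrm{src}} = (\mathcal{S}, \mathcal{A}, P_{\mathrm{src}}, r, \gamma)$ and $\mathcal{M}_{\mathrm{tar}} = (\mathcal{S}, \mathcal{A}, P_{\mathrm{tar}}, r, \gamma)$ be two Markov decision processes (source and target domain) with the same state space, action space, reward function $r:\mathcal{S}\times\mathcal{A}\to\mathbb{R}$, discount factor $\gamma\in[0,1)$ and initial state distribution, but possibly different transition dynamics $P_{\mathrm{src}}(s'\mid s,a)$ and $P_{\mathrm{tar}}(s'\mid s,a)$. Assume $|r(s,a)|\le r_{\max}$ for all $s\in\mathcal{S}$, $a\in\mathcal{A}$. Let $K\ge 1$, and suppose each of the two domains is equipped with a generative trajectory with $K$ latent states $s'_1,\dots,s'_K$ for the next state $s'_0=s'$ (as defined in the context). Then for every policy $\pi$, $$ \begin{aligned} \eta_{\mathcal{M}_{\mathrm{src}}}(\pi) - \eta_{\mathcal{M}_{\mathrm{tar}}}(\pi) \le{}& \frac{\sqrt{2}\,\gamma\, r_{\max}}{(1-\gamma)^2}\; \mathbb{E}_{(s,a)\sim\rho^{\pi}_{\mathrm{src}}}\left[\sqrt{\mathbb{E}_{P_{\mathrm{src}}}\left[D_{\mathrm{KL}}\big(P_{\mathrm{src}}(s'_K\mid s,a)\,\|\,P_{\mathrm{tar}}(s'_K\mid s,a)\big)\right]}\right] \\ &+ \frac{\sqrt{2}\,\gamma\, r_{\max}}{(1-\gamma)^2}\; \mathbb{E}_{(s,a)\sim\rho^{\pi}_{\mathrm{src}}}\left[\sqrt{\mathbb{E}_{P_{\mathrm{src}}}\left[\sum_{k=1}^{K}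 D_{\mathrm{KL}}\big(P_{\mathrm{src}}(s'_{k-1}\mid s'_k,s,a)\,\|\,P_{\mathrm{tar}}(s'_{k-1}\mid s'_k,s,a)\big)\right]}\right]. \end{aligned} $$
   Context: Policies, visitation and return. A policy $\pi$ is a conditional distribution $\pi(a\mid s)$ of actions given states. For a domain (MDP) $\mathcal{M}$, $P^{\pi}_{\mathcal{M},t}(s)$ denotes the probability that $\pi$ is in state $s$ at time step $t$ when run in $\mathcal{M}$ (from the initial state distribution, which is the same for both domains). The normalized discounted state-action visitation distribution is $$\rho^{\pi}_{\mathcal{M}}(s,a) := (1-\gamma)\sum_{t=0}^{\infty}\gamma^t P^{\pi}_{\mathcal{M},t}(s)\,\pi(a\mid s),$$ and the expected return of $\pi$ in $\mathcal{M}$ is $\eta_{\mathcal{M}}(\pi) = \mathbb{E}_{(s,a)\sim\rho^{\pi}_{\mathcal{M}}}[r(s,a)]$. We write $\rho^{\pi}_{\mathrm{src}} = \rho^{\pi}_{\mathcal{M}_{\mathrm{src}}}$. Generative trajectory. Write the next state $s'$ as $s'_0$. For a domain $\mathcal{M}$ with transition dynamics $P_{\mathcal{M}}(s'_0\mid s,a)$, a generative trajectory for $s'_0$ consists of $K$ auxiliary random variables $s'_1,\dots,s'_K$ (latent states) such that, conditionally on $(s,a)$, the sequence $s'_K, s'_{K-1},\dots,s'_1,s'_0$ is a Markov chain from the initial latent state $s'_K$ to the next state $s'_0$. That is, there is a joint conditional distribution $$P_{\mathcal{M}}(s'_{0:K}\mid s,a) = P_{\mathcal{M}}(s'_K\mid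 s,a)\prod_{k=1}^{K}P_{\mathcal{M}}(s'_{k-1}\mid s'_k,s,a)$$ whose marginal in $s'_0$ is the transition dynamics: $$P_{\mathcal{M}}(s'_0\mid s,a)=\int P_{\mathcal{M}}(s'_K\mid s,a)\prod_{k=1}^{K}P_{\mathcal{M}}(s'_{k-1}\mid s'_k,s,a)\,ds'_{1:K}.$$ The latent states of the two domains take values in the same spaces. $P_{\mathrm{src}}$ and $P_{\mathrm{tar}}$ also denote these joint, marginal and conditional distributions for $\mathcal{M}_{\mathrm{src}}$ and $\mathcal{M}_{\mathrm{tar}}$ respectively. Other notation. $D_{\mathrm{KL}}(P\|Q)$ is the Kullback–Leibler divergence (natural logarithm), with value in $[0,+\infty]$. The inner expectation $\mathbb{E}_{P_{\mathrm{src}}}$ is, for fixed $(s,a)$, over the latent states drawn from $P_{\mathrm{src}}(s'_{0:K}\mid s,a)$; in the first term the integrand does not depend on them, and in the second term the $k$-th summand is a function of $s'_k$. *)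

theory Defs
  imports "HOL-Probability.Probability"
begin

text \<open>
  States and actions form arbitrary measurable spaces \<open>S\<close> and \<open>A\<close>; dynamics, policies and
  latent transitions are Markov kernels, i.e. measurable maps into \<^const>\<open>prob_algebra\<close>.
\<close>

definition is_mdp ::
  "'s measure \<Rightarrow> 'a measure \<Rightarrow> 's measure \<Rightarrow> ('s \<times> 'a \<Rightarrow> 's measure) \<Rightarrow> ('s \<times> 'a \<Rightarrow> real)
    \<Rightarrow> real \<Rightarrow> bool" where
  "is_mdp S A \<mu> P r \<gamma> \<longleftrightarrow>
     \<mu> \<in> space (prob_algebra S) \<and>
     P \<in> S \<Otimes>\<^sub>M A \<rightarrow>\<^sub>M prob_algebra S \<and>
     r \<in> borel_measurable (S \<Otimes>\<^sub>M A) \<and>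
     0 \<le> \<gamma> \<and> \<gamma> < 1"

definition is_policy :: "'s measure \<Rightarrow> 'a measure \<Rightarrow> ('s \<Rightarrow> 'a measure) \<Rightarrow> bool" where
  "is_policy S A \<pi> \<longleftrightarrow> \<pi> \<in> S \<rightarrow>\<^sub>M prob_algebra A"

primrec state_dist ::
  "'s measure \<Rightarrow> ('s \<times> 'a \<Rightarrow> 's measure) \<Rightarrow> ('s \<Rightarrow> 'a measure) \<Rightarrow> nat \<Rightarrow> 's measure" where
  "state_dist \<mu> P \<pi> 0 = \<mu>"
| "state_dist \<mu> P \<pi> (Suc t) = state_dist \<mu> P \<pi> t \<bind> (\<lambda>s. \<pi> s \<bind> (\<lambda>a. P (s, a)))"

definition state_action_dist ::
  "'s measure \<Rightarrow> 'a measure \<Rightarrow> 's measure \<Rightarrow> ('s \<times> 'a \<Rightarrow> 's measure) \<Rightarrow> ('s \<Rightarrow> 'a measure)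
    \<Rightarrow> nat \<Rightarrow> ('s \<times> 'a) measure" where
  "state_action_dist S A \<mu> P \<pi> t =
     state_dist \<mu> P \<pi> t \<bind> (\<lambda>s. distr (\<pi> s) (S \<Otimes>\<^sub>M A) (\<lambda>a. (s, a)))"

definition visitation ::
  "'s measure \<Rightarrow> 'a measure \<Rightarrow> 's measure \<Rightarrow> ('s \<times> 'a \<Rightarrow> 's measure) \<Rightarrow> real
    \<Rightarrow> ('s \<Rightarrow> 'a measure) \<Rightarrow> ('s \<times> 'a) measure" where
  "visitation S A \<mu> P \<gamma> \<pi> =
     measure_of (space (S \<Otimes>\<^sub>M A)) (sets (S \<Otimes>\<^sub>M A))
       (\<lambda>B. ennreal (1 - \<gamma>) *
            (\<Sum>t. ennreal (\<gamma> ^ t) * emeasure (state_action_dist S A \<mu> P \<pi> t) B))"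

definition expected_return ::
  "'s measure \<Rightarrow> 'a measure \<Rightarrow> 's measure \<Rightarrow> ('s \<times> 'a \<Rightarrow> 's measure) \<Rightarrow> ('s \<times> 'a \<Rightarrow> real)
    \<Rightarrow> real \<Rightarrow> ('s \<Rightarrow> 'a measure) \<Rightarrow> real" where
  "expected_return S A \<mu> P r \<gamma> \<pi> = (\<integral>x. r x \<partial>visitation S A \<mu> P \<gamma> \<pi>)"

text \<open>
  Generative trajectories. \<open>Z k\<close> is the space of \<open>s'\<^sub>k\<close>, with \<open>Z 0 = S\<close>; the spaces \<open>Z k\<close> share
  the type of the states but are otherwise arbitrary (any family of measurable spaces can be
  placed in a common sum type). \<open>\<nu>\<close> is the law of the initial latent state \<open>s'\<^sub>K\<close>, and
  \<open>T k z\<close> is the law of \<open>s'\<^sub>k\<^sub>-\<^sub>1\<close> given \<open>s'\<^sub>k = z\<close> for \<open>1 \<le> k \<le> K\<close>.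
  After \<open>j\<close> steps the chain has produced the coordinates \<open>K - j, \<dots>, K\<close>.
\<close>

primrec latent_chain ::
  "(nat \<Rightarrow> 's measure) \<Rightarrow> nat \<Rightarrow> 's measure \<Rightarrow> (nat \<Rightarrow> 's \<Rightarrow> 's measure) \<Rightarrow> nat
    \<Rightarrow> (nat \<Rightarrow> 's) measure" where
  "latent_chain Z K \<nu> T 0 = distr \<nu> (Pi\<^sub>M {K..K} Z) (\<lambda>z. \<lambda>i\<in>{K..K}. z)"
| "latent_chain Z K \<nu> T (Suc j) =
     latent_chain Z K \<nu> T j \<bind>
       (\<lambda>\<omega>. distr (T (K - j) (\<omega> (K - j))) (Pi\<^sub>M {K - Suc j..K} Z) (\<lambda>z. fun_upd \<omega> (K - Suc j) z))"

text \<open>The joint conditional law of \<open>(s'\<^sub>0, \<dots>, s'\<^sub>K)\<close> given \<open>x = (s, a)\<close>.\<close>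

definition trajectory ::
  "(nat \<Rightarrow> 's measure) \<Rightarrow> nat \<Rightarrow> ('s \<times> 'a \<Rightarrow> 's measure) \<Rightarrow> (nat \<Rightarrow> 's \<times> ('s \<times> 'a) \<Rightarrow> 's measure)
    \<Rightarrow> 's \<times> 'a \<Rightarrow> (nat \<Rightarrow> 's) measure" where
  "trajectory Z K \<nu> T x = latent_chain Z K (\<nu> x) (\<lambda>k z. T k (z, x)) K"

definition is_generative_trajectory ::
  "'s measure \<Rightarrow> 'a measure \<Rightarrow> (nat \<Rightarrow> 's measure) \<Rightarrow> nat \<Rightarrow> ('s \<times> 'a \<Rightarrow> 's measure)
    \<Rightarrow> ('s \<times> 'a \<Rightarrow> 's measure) \<Rightarrow> (nat \<Rightarrow> 's \<times> ('s \<times> 'a) \<Rightarrow> 's measure) \<Rightarrow> bool" where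
  "is_generative_trajectory S A Z K P \<nu> T \<longleftrightarrow>
     Z 0 = S \<and>
     \<nu> \<in> S \<Otimes>\<^sub>M A \<rightarrow>\<^sub>M prob_algebra (Z K) \<and>
     (\<forall>k\<in>{1..K}. T k \<in> Z k \<Otimes>\<^sub>M (S \<Otimes>\<^sub>M A) \<rightarrow>\<^sub>M prob_algebra (Z (k - 1))) \<and>
     (\<forall>x\<in>space (S \<Otimes>\<^sub>M A). P x = distr (trajectory Z K \<nu> T x) (Z 0) (\<lambda>\<omega>. \<omega> 0))"

text \<open>
  \<^const>\<open>KL_divergence\<close> is real-valued and takes its arguments in the opposite order: \<open>D(P \<parallel> Q)\<close> is
  \<open>KL_divergence (exp 1) Q P\<close> whenever that is finite. For probability measures \<open>P \<lless> Q\<close> the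
  negative part of \<open>ln (dP/dQ)\<close> is always \<open>P\<close>-integrable, so non-integrability means that the
  divergence is infinite.
\<close>

definition KL_div :: "'x measure \<Rightarrow> 'x measure \<Rightarrow> ennreal" where
  "KL_div P Q =
     (if absolutely_continuous Q P \<and> integrable P (entropy_density (exp 1) Q P)
      then ennreal (KL_divergence (exp 1) Q P) else \<top>)"

definition ennreal_sqrt :: "ennreal \<Rightarrow> ennreal" where
  "ennreal_sqrt x = (if x = \<top> then \<top> else ennreal (sqrt (enn2real x)))"

text \<open>
  Expectations of \<open>[0, \<infinity>]\<close>-valued functions are taken with \<^const>\<open>nn_integral\<close>. On arbitrary
  measurable spaces the divergence of two kernels need not be a measurable function of the
  conditioning variables; \<^const>\<open>nn_integral\<close> is then the lower integral, so an upper bound in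
  terms of it makes no measurability assumption and is at least as strong as one that does.
\<close>

end

theory Submission
  imports Defs
begin

text \<open>
  Let \<open>V\<close> be the value function of \<open>\<pi>\<close> in the target domain, so \<open>\<bar>V\<bar> \<le> C\<close> with
  \<open>C = r_max / (1 - \<gamma>)\<close>. Bellman's equation and the flow equation of the visitation distribution give
  \<open>\<eta>_src - \<eta>_tar = \<gamma> E[P_src V - P_tar V]\<close>, the expectation being over \<open>\<rho>_src\<close>; below, \<open>V\<close> is
  replaced by its \<open>n\<close>-step approximation, at the cost of an error of order \<open>\<gamma>\<^sup>n\<close>.
  The divergences need not be measurable, so the integrals on the right are lower integrals and the
  gap must be split into two measurable parts before anything is estimated. With \<open>V\<^sub>K(z)\<close> the target
  expectation of \<open>V(s'\<^sub>0)\<close> given \<open>s'\<^sub>K = z\<close>, these are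
  \<open>g\<^sub>1 = \<nu>_src V\<^sub>K - \<nu>_tar V\<^sub>K\<close> and \<open>g\<^sub>2 = E_src[V(s'\<^sub>0) - V\<^sub>K(s'\<^sub>K)]\<close>.
  Each is bounded by \<open>\<surd>2 C\<close> times the square root of its divergence: apply the
  Donsker-Varadhan inequality to \<open>\<lambda> V\<close>, bound the log-moment generating function with
  Hoeffding's lemma, and optimise over \<open>\<lambda> > 0\<close>. For \<open>g\<^sub>2\<close> the inequality is applied along the chain to
  \<open>W\<^sub>k(z) = ln E_tar[exp (\<lambda> V(s'\<^sub>0)) | s'\<^sub>k = z]\<close>, where the log-Laplace terms telescope; this replaces
  the chain rule for the divergence and loses no factor \<open>\<surd>K\<close>.
\<close>

section \<open>Integrals against Markov kernels\<close>

lemma space_prob_algebraD: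
  assumes "N \<in> space (prob_algebra M)"
  shows "sets N = sets M" "space N = space M" "prob_space N"
  using assms by (auto simp: space_prob_algebra dest: sets_eq_imp_space_eq)

lemma prob_algebra_integrable:
  fixes f :: "'x \<Rightarrow> real"
  assumes N: "N \<in> space (prob_algebra M)" and f: "f \<in> borel_measurable M"
    and b: "\<And>x. x \<in> space M \<Longrightarrow> \<bar>f x\<bar> \<le> B"
  shows "integrable N f"
proof -
  note s = space_prob_algebraD[OF N]
  interpret prob_space N by fact
  have "f \<in> borel_measurable N" using f s(1) by (simp cong: measurable_cong_sets)
  then show ?thesis
    by (intro integrable_const_bound[where B=B]) (auto simp: b s)
qed

lemma prob_algebra_abs_integral_le:
  fixes f :: "'x \<Rightarrow> real"
  assumes N: "N \<in> space (prob_algebra M)"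
    and b: "\<And>x. x \<in> space M \<Longrightarrow> \<bar>f x\<bar> \<le> B"
  shows "\<bar>\<integral>x. f x \<partial>N\<bar> \<le> B"
proof -
  note s = space_prob_algebraD[OF N]
  interpret prob_space N by fact
  obtain x where x: "x \<in> space M" using not_empty s by auto
  then have B: "0 \<le> B" using b[OF x] by linarith
  show ?thesis
  proof (cases "integrable N f")
    case True
    have "\<bar>\<integral>x. f x \<partial>N\<bar> \<le> (\<integral>x. \<bar>f x\<bar> \<partial>N)" by simp
    also have "\<dots> \<le> (\<integral>x. B \<partial>N)"
      using True by (intro integral_mono) (auto simp: b s)
    finally show ?thesis by (simp add: prob_space)
  next
    case False
    then show ?thesis using B by (simp add: not_integrable_integral_eq)
  qed
qed

lemma kernel_integral_measurable:
  fixes f :: "'y \<Rightarrow> real"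
  assumes "\<kappa> \<in> M \<rightarrow>\<^sub>M prob_algebra N" "f \<in> borel_measurable N"
  shows "(\<lambda>x. \<integral>y. f y \<partial>\<kappa> x) \<in> borel_measurable M"
  using measurable_compose[OF measurable_prob_algebraD[OF assms(1)]
      integral_measurable_subprob_algebra[OF assms(2)]] .

text \<open>Pushing \<open>\<kappa> x\<close> forward along the pairing with \<open>x\<close> gives
  a kernel into the product space. Against it the integrand is fixed, which reduces the claim to the
  version whose integrand does not vary with \<open>x\<close>.\<close>

lemma kernel_integral_measurable2:
  fixes f :: "'x \<times> 'y \<Rightarrow> real"
  assumes k: "\<kappa> \<in> M \<rightarrow>\<^sub>M prob_algebra N" and f: "f \<in> borel_measurable (M \<Otimes>\<^sub>M N)"
  shows "(\<lambda>x. \<integral>y. f (x, y) \<partial>\<kappa> x) \<in> borel_measurable M"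
    and "x \<in> space M \<Longrightarrow> (\<integral>w. f w \<partial>distr (\<kappa> x) (M \<Otimes>\<^sub>M N) (\<lambda>y. (x, y))) = (\<integral>y. f (x, y) \<partial>\<kappa> x)"
proof -
  have k': "(\<lambda>x. distr (\<kappa> x) (M \<Otimes>\<^sub>M N) (\<lambda>y. (x, y))) \<in> M \<rightarrow>\<^sub>M prob_algebra (M \<Otimes>\<^sub>M N)"
    by (rule measurable_distr_prob_space2[OF k]) measurable
  show eq: "(\<integral>w. f w \<partial>distr (\<kappa> x) (M \<Otimes>\<^sub>M N) (\<lambda>y. (x, y))) = (\<integral>y. f (x, y) \<partial>\<kappa> x)"
    if x: "x \<in> space M" for x
  proof -
    have s: "sets (\<kappa> x) = sets N" using space_prob_algebraD(1)[OF measurable_space[OF k x]] .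
    have "(\<lambda>y. (x, y)) \<in> \<kappa> x \<rightarrow>\<^sub>M M \<Otimes>\<^sub>M N"
      unfolding measurable_cong_sets[OF s refl] by (rule measurable_Pair1'[OF x])
    from integral_distr[OF this f] show ?thesis .
  qed
  show "(\<lambda>x. \<integral>y. f (x, y) \<partial>\<kappa> x) \<in> borel_measurable M"
    using kernel_integral_measurable[OF k' f] eq by (simp cong: measurable_cong)
qed

lemma integral_bind_prob_algebra:
  fixes f :: "'y \<Rightarrow> real"
  assumes N: "N \<in> space (prob_algebra M)" and k: "\<kappa> \<in> M \<rightarrow>\<^sub>M prob_algebra L"
    and f: "f \<in> borel_measurable L" and b: "\<And>y. y \<in> space L \<Longrightarrow> \<bar>f y\<bar> \<le> B"
  shows "(\<integral>y. f y \<partial>(N \<bind> \<kappa>)) = (\<integral>x. \<integral>y. f y \<partial>\<kappa> x \<partial>N)"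
proof -
  note s = space_prob_algebraD[OF N]
  interpret prob_space N by fact
  have k': "\<kappa> \<in> N \<rightarrow>\<^sub>M subprob_algebra L"
    using measurable_prob_algebraD[OF k] s(1) by (simp cong: measurable_cong_sets)
  show ?thesis
  proof (rule integral_bind[OF f b k', where B'=1])
    show "finite_measure N" by unfold_locales
    show "AE x in N. emeasure (\<kappa> x) (space (\<kappa> x)) \<le> ennreal 1"
      using measurable_space[OF k] s
      by (auto intro!: prob_space.emeasure_space_1[THEN eq_refl] simp: space_prob_algebra)
  qed
qed

lemma bind_in_prob_algebra:
  "N \<in> space (prob_algebra M) \<Longrightarrow> \<kappa> \<in> M \<rightarrow>\<^sub>M prob_algebra L \<Longrightarrow> N \<bind> \<kappa> \<in> space (prob_algebra L)"
  by (simp add: space_prob_algebra[of L] prob_space_bind' sets_bind')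

text \<open>The positive lower bound lets logarithms of such integrals be taken and keeps them
  between \<open>- B\<close> and \<open>B\<close>.\<close>

lemma prob_algebra_integral_exp:
  fixes f :: "'x \<Rightarrow> real"
  assumes N: "N \<in> space (prob_algebra M)" and f: "f \<in> borel_measurable M"
    and b: "\<And>x. x \<in> space M \<Longrightarrow> \<bar>f x\<bar> \<le> B"
  shows "exp (- B) \<le> (\<integral>x. exp (f x) \<partial>N)" "(\<integral>x. exp (f x) \<partial>N) \<le> exp B"
    "integrable N (\<lambda>x. exp (f x))"
proof -
  note s = space_prob_algebraD[OF N]
  interpret prob_space N by fact
  have m: "(\<lambda>x. exp (f x)) \<in> borel_measurable M" using f by measurable
  have bb: "\<bar>exp (f x)\<bar> \<le> exp B" "exp (- B) \<le> exp (f x)" if "x \<in> space M" for x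
    using b[OF that] by auto
  show i: "integrable N (\<lambda>x. exp (f x))"
    by (rule prob_algebra_integrable[OF N m bb(1)])
  have "(\<integral>x. exp (- B) \<partial>N) \<le> (\<integral>x. exp (f x) \<partial>N)"
    by (intro integral_mono i) (auto simp: bb s simp del: exp_le_cancel_iff)
  then show "exp (- B) \<le> (\<integral>x. exp (f x) \<partial>N)" by (simp add: prob_space)
  show "(\<integral>x. exp (f x) \<partial>N) \<le> exp B"
    using prob_algebra_abs_integral_le[OF N bb(1)] by simp
qed

section \<open>Donsker-Varadhan and transport inequalities\<close>

text \<open>For an infinite divergence there is nothing to prove. Otherwise
  \<open>exp u \<ge> 1 + u\<close> is used with \<open>u = f - ln h - ln Z\<close>, where
  \<open>h\<close> is the density of \<open>P\<close> and \<open>Z\<close> normalises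
  \<open>exp f\<close> under \<open>Q\<close>; the resulting upper bound integrates to 1.\<close>

lemma Donsker_Varadhan:
  fixes f :: "'x \<Rightarrow> real"
  assumes P: "P \<in> space (prob_algebra M)" and Q: "Q \<in> space (prob_algebra M)"
    and f: "f \<in> borel_measurable M" and b: "\<And>x. x \<in> space M \<Longrightarrow> \<bar>f x\<bar> \<le> B"
  shows "ennreal ((\<integral>x. f x \<partial>P) - ln (\<integral>x. exp (f x) \<partial>Q)) \<le> KL_div P Q"
proof (cases "absolutely_continuous Q P \<and> integrable P (entropy_density (exp 1) Q P)")
  case False
  then show ?thesis by (auto simp: KL_div_def)
next
  case True
  note sP = space_prob_algebraD[OF P]
  note sQ = space_prob_algebraD[OF Q]
  interpret P: prob_space P by fact
  interpret Q: prob_space Q by fact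
  have fQ: "f \<in> borel_measurable Q" using f sQ(1) by (simp cong: measurable_cong_sets)
  have fP: "f \<in> borel_measurable P" using f sP(1) by (simp cong: measurable_cong_sets)
  have sPQ: "sets P = sets Q" using sP sQ by simp
  have sigP: "sigma_finite_measure P" by unfold_locales
  \<comment> \<open>Multiplying by the density \<open>h\<close> turns the claim into
    \<open>h * (f - ln h - ln Z + 1) \<le> exp f / Z\<close>, which also holds where \<open>h = 0\<close>.\<close>
  define D where "D = entropy_density (exp 1) Q P"
  define h where "h x = enn2real (RN_deriv Q P x)" for x
  define Z where "Z = (\<integral>x. exp (f x) \<partial>Q)"
  have D: "D x = ln (h x)" for x
    by (simp add: D_def h_def entropy_density_def log_def)
  have Z: "Z > 0"
    using prob_algebra_integral_exp(1)[OF Q f b] unfolding Z_def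
    by (meson exp_gt_zero less_le_trans)
  have ie: "integrable Q (\<lambda>x. exp (f x))" by (rule prob_algebra_integral_exp(3)[OF Q f b])
  have iD: "integrable P D" using True by (simp add: D_def)
  have ifP: "integrable P f" by (rule prob_algebra_integrable[OF P f b])
  define \<phi> where "\<phi> x = f x - D x - ln Z + 1" for x
  have mD: "D \<in> borel_measurable Q" unfolding D_def by measurable
  have m\<phi>: "\<phi> \<in> borel_measurable Q" unfolding \<phi>_def using fQ mD by measurable
  have i\<phi>: "integrable P \<phi>" unfolding \<phi>_def using ifP iD by auto
  have int: "(\<integral>x. \<phi> x \<partial>P) = (\<integral>x. f x \<partial>P) - (\<integral>x. D x \<partial>P) - ln Z + 1"
    unfolding \<phi>_def using ifP iD by (simp add: P.prob_space)
  have "(\<integral>x. \<phi> x \<partial>P) = (\<integral>x. h x * \<phi> x \<partial>Q)"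
    unfolding h_def by (rule Q.RN_deriv_integral[OF sigP _ sPQ m\<phi>]) (use True in simp)
  also have "\<dots> \<le> (\<integral>x. exp (f x) / Z \<partial>Q)"
  proof (rule integral_mono)
    show "integrable Q (\<lambda>x. h x * \<phi> x)"
      using Q.RN_deriv_integrable[OF sigP _ sPQ m\<phi>] True i\<phi> by (simp add: h_def)
    show "integrable Q (\<lambda>x. exp (f x) / Z)" using ie by simp
    fix x
    have "0 \<le> h x" by (simp add: h_def)
    then consider "h x = 0" | "h x > 0" by linarith
    then show "h x * \<phi> x \<le> exp (f x) / Z"
    proof cases
      case 1
      then show ?thesis using Z by simp
    next
      case 2
      have "\<phi> x \<le> exp (f x - ln (h x) - ln Z)"
        using exp_ge_add_one_self[of "f x - ln (h x) - ln Z"] unfolding \<phi>_def D by linarith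
      also have "\<dots> = exp (f x) / h x / Z" using 2 Z by (simp add: exp_diff)
      finally have "h x * \<phi> x \<le> h x * (exp (f x) / h x / Z)" using 2 by (intro mult_left_mono) auto
      then show ?thesis using 2 by simp
    qed
  qed
  also have "\<dots> = 1" using Z by (simp add: Z_def)
  finally have "(\<integral>x. f x \<partial>P) - ln Z \<le> (\<integral>x. D x \<partial>P)" using int by simp
  then show ?thesis
    using True by (simp add: KL_div_def KL_divergence_def D_def Z_def ennreal_leI)
qed

text \<open>Hoeffding's lemma for the range \<open>[-C, C]\<close>, of width \<open>2 * C\<close>,
  bounds the moment generating function of the centred \<open>f\<close>, and
  \<open>(2 * C)\<^sup>2 / 8 = C\<^sup>2 / 2\<close>. Restoring the mean gives the linear
  term.\<close>

lemma ln_mgf_le: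
  fixes f :: "'x \<Rightarrow> real"
  assumes Q: "Q \<in> space (prob_algebra M)" and f: "f \<in> borel_measurable M"
    and b: "\<And>x. x \<in> space M \<Longrightarrow> \<bar>f x\<bar> \<le> C" and l: "l > 0"
  shows "ln (\<integral>x. exp (l * f x) \<partial>Q) \<le> l * (\<integral>x. f x \<partial>Q) + l\<^sup>2 * C\<^sup>2 / 2"
proof -
  note sQ = space_prob_algebraD[OF Q]
  interpret Q: prob_space Q by fact
  have fQ: "f \<in> borel_measurable Q" using f sQ(1) by (simp cong: measurable_cong_sets)
  interpret interval_bounded_random_variable Q f "-C" C
    using b sQ fQ by unfold_locales (auto simp: abs_le_iff minus_le_iff)
  let ?m = "\<integral>x. f x \<partial>Q"
  have m: "(\<lambda>x. l * f x) \<in> borel_measurable M" using f by measurable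
  have bb: "\<bar>l * f x\<bar> \<le> l * C" if "x \<in> space M" for x
    using b[OF that] l by (simp add: abs_mult)
  have ie: "integrable Q (\<lambda>x. exp (l * f x))"
    and pos: "(\<integral>x. exp (l * f x) \<partial>Q) > 0"
    using prob_algebra_integral_exp[OF Q m bb] exp_gt_zero less_le_trans by (blast+)
  have eq: "exp (l * (f x - ?m)) = exp (l * f x) * exp (- l * ?m)" for x
    by (simp add: algebra_simps flip: exp_add)
  have i2: "integrable Q (\<lambda>x. exp (l * (f x - ?m)))"
    unfolding eq using ie by auto
  have "ennreal (\<integral>x. exp (l * (f x - ?m)) \<partial>Q) \<le> ennreal (exp (l\<^sup>2 * (C - (-C))\<^sup>2 / 8))"
    using Hoeffdings_lemma_nn_integral[OF l] i2
    by (simp add: nn_integral_eq_integral algebra_simps)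
  then have "(\<integral>x. exp (l * (f x - ?m)) \<partial>Q) \<le> exp (l\<^sup>2 * C\<^sup>2 / 2)"
    by (simp add: power2_eq_square algebra_simps)
  then have "(\<integral>x. exp (l * f x) \<partial>Q) * exp (- l * ?m) \<le> exp (l\<^sup>2 * C\<^sup>2 / 2)"
    unfolding eq by simp
  then have "(\<integral>x. exp (l * f x) \<partial>Q) \<le> exp (l * ?m + l\<^sup>2 * C\<^sup>2 / 2)"
    unfolding exp_add by (simp add: exp_minus field_simps)
  then have "ln (\<integral>x. exp (l * f x) \<partial>Q) \<le> ln (exp (l * ?m + l\<^sup>2 * C\<^sup>2 / 2))"
    using pos by (subst ln_le_cancel_iff) auto
  then show ?thesis by simp
qed

text \<open>For \<open>d > 0\<close> the supremum of the left-hand sides over \<open>l > 0\<close>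
  is \<open>d\<^sup>2 / (2 * C\<^sup>2)\<close>. If \<open>X = \<top>\<close>, the right-hand side
  is infinite because \<open>C > 0\<close>; if \<open>d \<le> 0\<close>, the left-hand side is 0.
  \<open>X\<close> stays abstract so that a single divergence and an expected sum of divergences are
  both covered.\<close>

lemma le_ennreal_sqrtI:
  assumes C: "C > 0" and h: "\<And>l. l > 0 \<Longrightarrow> ennreal (l * d - l\<^sup>2 * C\<^sup>2 / 2) \<le> X"
  shows "ennreal d \<le> ennreal (sqrt 2 * C) * ennreal_sqrt X"
proof (cases "X = \<top> \<or> d \<le> 0")
  case True
  then show ?thesis
    using C by (auto simp: ennreal_sqrt_def ennreal_mult_top ennreal_neg)
next
  case False
  then have d: "d > 0" and X: "X = ennreal (enn2real X)"
    by (auto simp: less_top)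
  define L where "L = enn2real X"
  have L: "L \<ge> 0" by (simp add: L_def)
  \<comment> \<open>\<open>l = d / C\<^sup>2\<close> maximises \<open>l * d - l\<^sup>2 * C\<^sup>2 / 2\<close>.\<close>
  have "d / C\<^sup>2 > 0" using d C by simp
  from h[OF this] have "ennreal ((d / C\<^sup>2) * d - (d / C\<^sup>2)\<^sup>2 * C\<^sup>2 / 2) \<le> ennreal L"
    using X by (simp add: L_def)
  then have "(d / C\<^sup>2) * d - (d / C\<^sup>2)\<^sup>2 * C\<^sup>2 / 2 \<le> L" using L by simp
  moreover have "(d / C\<^sup>2) * d - (d / C\<^sup>2)\<^sup>2 * C\<^sup>2 / 2 = d\<^sup>2 / (2 * C\<^sup>2)"
    using C by (simp add: field_simps power2_eq_square)
  ultimately have "d\<^sup>2 / (2 * C\<^sup>2) \<le> L" by linarith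
  then have "d\<^sup>2 \<le> 2 * C\<^sup>2 * L" using C by (simp add: field_simps)
  then have "sqrt (d\<^sup>2) \<le> sqrt (2 * C\<^sup>2 * L)" by (rule real_sqrt_le_mono)
  then have "d \<le> sqrt 2 * C * sqrt L" using d C by (simp add: real_sqrt_mult)
  then show ?thesis
    using False C L by (simp add: ennreal_sqrt_def L_def[symmetric] ennreal_leI flip: ennreal_mult)
qed

text \<open>Donsker-Varadhan for \<open>l * f\<close>, with the log-moment generating function under
  \<open>Q\<close> replaced by its Hoeffding bound. The constant is the one that Pinsker's
  inequality yields for test functions bounded by \<open>C\<close>.\<close>

lemma KL_transport:
  fixes f :: "'x \<Rightarrow> real"
  assumes P: "P \<in> space (prob_algebra M)" and Q: "Q \<in> space (prob_algebra M)"
    and f: "f \<in> borel_measurable M" and b: "\<And>x. x \<in> space M \<Longrightarrow> \<bar>f x\<bar> \<le> C" and C: "C > 0"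
  shows "ennreal ((\<integral>x. f x \<partial>P) - (\<integral>x. f x \<partial>Q)) \<le> ennreal (sqrt 2 * C) * ennreal_sqrt (KL_div P Q)"
proof (rule le_ennreal_sqrtI[OF C])
  fix l :: real assume l: "l > 0"
  have m: "(\<lambda>x. l * f x) \<in> borel_measurable M" using f by measurable
  have bb: "\<bar>l * f x\<bar> \<le> l * C" if "x \<in> space M" for x
    using b[OF that] l by (simp add: abs_mult)
  have "l * ((\<integral>x. f x \<partial>P) - (\<integral>x. f x \<partial>Q)) - l\<^sup>2 * C\<^sup>2 / 2
      \<le> (\<integral>x. l * f x \<partial>P) - ln (\<integral>x. exp (l * f x) \<partial>Q)"
    using ln_mgf_le[OF Q f b l] by (simp add: algebra_simps)
  then show "ennreal (l * ((\<integral>x. f x \<partial>P) - (\<integral>x. f x \<partial>Q)) - l\<^sup>2 * C\<^sup>2 / 2) \<le> KL_div P Q"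
    using Donsker_Varadhan[OF P Q m bb] by (meson ennreal_leI order_trans)
qed

section \<open>The latent chain\<close>

lemma measurable_apply_component:
  "f \<in> M k \<rightarrow>\<^sub>M L \<Longrightarrow> k \<in> I \<Longrightarrow> (\<lambda>\<omega>. f (\<omega> k)) \<in> Pi\<^sub>M I M \<rightarrow>\<^sub>M L"
  by (rule measurable_compose[where f="\<lambda>\<omega>. \<omega> k", OF measurable_component_singleton])

lemma space_PiM_component: "\<omega> \<in> space (Pi\<^sub>M I M) \<Longrightarrow> k \<in> I \<Longrightarrow> \<omega> k \<in> space (M k)"
  by (auto simp: space_PiM)

context
  fixes Z :: "nat \<Rightarrow> 's measure" and K :: nat and T :: "nat \<Rightarrow> 's \<Rightarrow> 's measure"
  assumes T: "\<And>k. k \<in> {1..K} \<Longrightarrow> T k \<in> Z k \<rightarrow>\<^sub>M prob_algebra (Z (k - 1))"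
begin

text \<open>The first part is the kernel that one recursion step of \<open>latent_chain\<close>
  binds with. The other two are its ingredients, kept accessible because the push-forward is undone
  again when a step is integrated.\<close>

lemma latent_step_measurable:
  assumes j: "Suc j \<le> K"
  shows "(\<lambda>\<omega>. distr (T (K - j) (\<omega> (K - j))) (Pi\<^sub>M {K - Suc j..K} Z) (\<lambda>z. fun_upd \<omega> (K - Suc j) z))
      \<in> Pi\<^sub>M {K - j..K} Z \<rightarrow>\<^sub>M prob_algebra (Pi\<^sub>M {K - Suc j..K} Z)"
    and "(\<lambda>(\<omega>, z). fun_upd \<omega> (K - Suc j) z)
      \<in> Pi\<^sub>M {K - j..K} Z \<Otimes>\<^sub>M Z (K - Suc j) \<rightarrow>\<^sub>M Pi\<^sub>M {K - Suc j..K} Z"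
    and "(\<lambda>\<omega>. T (K - j) (\<omega> (K - j))) \<in> Pi\<^sub>M {K - j..K} Z \<rightarrow>\<^sub>M prob_algebra (Z (K - Suc j))"
proof -
  have ins: "insert (K - Suc j) {K - j..K} = {K - Suc j..K}" using j by auto
  show m: "(\<lambda>(\<omega>, z). fun_upd \<omega> (K - Suc j) z)
      \<in> Pi\<^sub>M {K - j..K} Z \<Otimes>\<^sub>M Z (K - Suc j) \<rightarrow>\<^sub>M Pi\<^sub>M {K - Suc j..K} Z"
    using measurable_add_dim[of "K - Suc j" "{K - j..K}" Z] unfolding ins .
  have Tm: "T (K - j) \<in> Z (K - j) \<rightarrow>\<^sub>M prob_algebra (Z (K - Suc j))"
    using T[of "K - j"] j by simp
  show t: "(\<lambda>\<omega>. T (K - j) (\<omega> (K - j))) \<in> Pi\<^sub>M {K - j..K} Z \<rightarrow>\<^sub>M prob_algebra (Z (K - Suc j))"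
    by (rule measurable_apply_component[where M=Z, OF Tm]) simp
  show "(\<lambda>\<omega>. distr (T (K - j) (\<omega> (K - j))) (Pi\<^sub>M {K - Suc j..K} Z) (\<lambda>z. fun_upd \<omega> (K - Suc j) z))
      \<in> Pi\<^sub>M {K - j..K} Z \<rightarrow>\<^sub>M prob_algebra (Pi\<^sub>M {K - Suc j..K} Z)"
    by (rule measurable_distr_prob_space2[OF t m])
qed

lemma latent_init_measurable: "(\<lambda>z. \<lambda>i\<in>{K..K}. z) \<in> Z K \<rightarrow>\<^sub>M Pi\<^sub>M {K..K} Z"
  by (rule measurable_restrict) auto

lemma latent_chain_in:
  assumes \<nu>: "\<nu> \<in> space (prob_algebra (Z K))"
  shows "j \<le> K \<Longrightarrow> latent_chain Z K \<nu> T j \<in> space (prob_algebra (Pi\<^sub>M {K - j..K} Z))"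
proof (induction j)
  case 0
  then show ?case
    using measurable_space[OF measurable_distr_prob_space[OF latent_init_measurable] \<nu>] by simp
next
  case (Suc j)
  then show ?case
    using bind_in_prob_algebra[OF _ latent_step_measurable(1)[of j]] by simp
qed

text \<open>Fubini for the coordinate drawn last: the bind becomes an iterated integral, and the
  push-forward along the function update is undone. \<open>F\<close> may read every coordinate drawn
  so far.\<close>

lemma integral_latent_chain_Suc:
  fixes F :: "(nat \<Rightarrow> 's) \<Rightarrow> real"
  assumes \<nu>: "\<nu> \<in> space (prob_algebra (Z K))" and j: "Suc j \<le> K"
    and F: "F \<in> borel_measurable (Pi\<^sub>M {K - Suc j..K} Z)"
    and b: "\<And>\<omega>. \<omega> \<in> space (Pi\<^sub>M {K - Suc j..K} Z) \<Longrightarrow> \<bar>F \<omega>\<bar> \<le> B"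
  shows "(\<integral>\<omega>. F \<omega> \<partial>latent_chain Z K \<nu> T (Suc j)) =
    (\<integral>\<omega>. \<integral>z. F (fun_upd \<omega> (K - Suc j) z) \<partial>T (K - j) (\<omega> (K - j)) \<partial>latent_chain Z K \<nu> T j)"
proof -
  note st = latent_step_measurable[OF j]
  have L: "latent_chain Z K \<nu> T j \<in> space (prob_algebra (Pi\<^sub>M {K - j..K} Z))"
    using latent_chain_in[OF \<nu>] j by simp
  have "(\<integral>\<omega>. F \<omega> \<partial>latent_chain Z K \<nu> T (Suc j)) =
    (\<integral>\<omega>. \<integral>\<omega>'. F \<omega>' \<partial>distr (T (K - j) (\<omega> (K - j))) (Pi\<^sub>M {K - Suc j..K} Z) (\<lambda>z. fun_upd \<omega> (K - Suc j) z)
       \<partial>latent_chain Z K \<nu> T j)"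
    unfolding latent_chain.simps by (rule integral_bind_prob_algebra[OF L st(1) F b])
  also have "\<dots> = (\<integral>\<omega>. \<integral>z. F (fun_upd \<omega> (K - Suc j) z) \<partial>T (K - j) (\<omega> (K - j)) \<partial>latent_chain Z K \<nu> T j)"
  proof (rule Bochner_Integration.integral_cong[OF refl])
    fix \<omega> assume "\<omega> \<in> space (latent_chain Z K \<nu> T j)"
    then have w: "\<omega> \<in> space (Pi\<^sub>M {K - j..K} Z)" using space_prob_algebraD(2)[OF L] by simp
    have s: "sets (T (K - j) (\<omega> (K - j))) = sets (Z (K - Suc j))"
      using space_prob_algebraD(1)[OF measurable_space[OF st(3) w]] .
    have "fun_upd \<omega> (K - Suc j) \<in> Z (K - Suc j) \<rightarrow>\<^sub>M Pi\<^sub>M {K - Suc j..K} Z"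
      using measurable_compose[OF measurable_Pair1'[OF w] st(2)] by simp
    then show "(\<integral>\<omega>'. F \<omega>' \<partial>distr (T (K - j) (\<omega> (K - j))) (Pi\<^sub>M {K - Suc j..K} Z) (\<lambda>z. fun_upd \<omega> (K - Suc j) z))
       = (\<integral>z. F (fun_upd \<omega> (K - Suc j) z) \<partial>T (K - j) (\<omega> (K - j)))"
      unfolding measurable_cong_sets[OF s refl, symmetric] by (rule integral_distr[OF _ F])
  qed
  finally show ?thesis .
qed

section \<open>Expectations of single coordinates of the chain\<close>

lemma integral_latent_chain_new:
  fixes f :: "'s \<Rightarrow> real"
  assumes \<nu>: "\<nu> \<in> space (prob_algebra (Z K))" and j: "Suc j \<le> K"
    and f: "f \<in> borel_measurable (Z (K - Suc j))"
    and b: "\<And>z. z \<in> space (Z (K - Suc j)) \<Longrightarrow> \<bar>f z\<bar> \<le> B"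
  shows "(\<integral>\<omega>. f (\<omega> (K - Suc j)) \<partial>latent_chain Z K \<nu> T (Suc j)) =
    (\<integral>\<omega>. \<integral>z. f z \<partial>T (K - j) (\<omega> (K - j)) \<partial>latent_chain Z K \<nu> T j)"
proof -
  have "(\<integral>\<omega>. f (\<omega> (K - Suc j)) \<partial>latent_chain Z K \<nu> T (Suc j)) =
    (\<integral>\<omega>. \<integral>z. f (fun_upd \<omega> (K - Suc j) z (K - Suc j)) \<partial>T (K - j) (\<omega> (K - j)) \<partial>latent_chain Z K \<nu> T j)"
  proof (rule integral_latent_chain_Suc[OF \<nu> j, where B=B])
    show "(\<lambda>\<omega>. f (\<omega> (K - Suc j))) \<in> borel_measurable (Pi\<^sub>M {K - Suc j..K} Z)"
      by (rule measurable_apply_component[where M=Z, OF f]) simp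
    show "\<bar>f (\<omega> (K - Suc j))\<bar> \<le> B" if "\<omega> \<in> space (Pi\<^sub>M {K - Suc j..K} Z)" for \<omega>
      using b[OF space_PiM_component[OF that]] by simp
  qed
  then show ?thesis by simp
qed

text \<open>The inner integrand does not read the coordinate being drawn, so it is constant, and the
  kernel has mass one.\<close>

lemma integral_latent_chain_old:
  fixes f :: "'s \<Rightarrow> real"
  assumes \<nu>: "\<nu> \<in> space (prob_algebra (Z K))" and j: "Suc j \<le> K" and k: "k \<in> {K - j..K}"
    and f: "f \<in> borel_measurable (Z k)"
    and b: "\<And>z. z \<in> space (Z k) \<Longrightarrow> \<bar>f z\<bar> \<le> B"
  shows "(\<integral>\<omega>. f (\<omega> k) \<partial>latent_chain Z K \<nu> T (Suc j)) = (\<integral>\<omega>. f (\<omega> k) \<partial>latent_chain Z K \<nu> T j)"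
proof -
  have L: "latent_chain Z K \<nu> T j \<in> space (prob_algebra (Pi\<^sub>M {K - j..K} Z))"
    using latent_chain_in[OF \<nu>] j by simp
  have "(\<integral>\<omega>. f (\<omega> k) \<partial>latent_chain Z K \<nu> T (Suc j)) =
    (\<integral>\<omega>. \<integral>z. f (fun_upd \<omega> (K - Suc j) z k) \<partial>T (K - j) (\<omega> (K - j)) \<partial>latent_chain Z K \<nu> T j)"
  proof (rule integral_latent_chain_Suc[OF \<nu> j, where B=B])
    have k': "k \<in> {K - Suc j..K}" using k by auto
    show "(\<lambda>\<omega>. f (\<omega> k)) \<in> borel_measurable (Pi\<^sub>M {K - Suc j..K} Z)"
      by (rule measurable_apply_component[where M=Z, OF f k'])
    show "\<bar>f (\<omega> k)\<bar> \<le> B" if "\<omega> \<in> space (Pi\<^sub>M {K - Suc j..K} Z)" for \<omega>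
      by (rule b[OF space_PiM_component[OF that k']])
  qed
  also have "\<dots> = (\<integral>\<omega>. f (\<omega> k) \<partial>latent_chain Z K \<nu> T j)"
  proof (rule Bochner_Integration.integral_cong[OF refl])
    fix \<omega> assume "\<omega> \<in> space (latent_chain Z K \<nu> T j)"
    then have w: "\<omega> \<in> space (Pi\<^sub>M {K - j..K} Z)" using space_prob_algebraD(2)[OF L] by simp
    interpret prob_space "T (K - j) (\<omega> (K - j))"
      using space_prob_algebraD(3)[OF measurable_space[OF latent_step_measurable(3)[OF j] w]] .
    have "k \<noteq> K - Suc j" using k j by auto
    then show "(\<integral>z. f (fun_upd \<omega> (K - Suc j) z k) \<partial>T (K - j) (\<omega> (K - j))) = f (\<omega> k)"
      by (simp add: prob_space)
  qed
  finally show ?thesis .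
qed

text \<open>Coordinate \<open>k\<close> is present after \<open>K - k\<close> steps, and the later
  steps do not change its expectations.\<close>

lemma integral_latent_chain_coord:
  fixes f :: "'s \<Rightarrow> real"
  assumes \<nu>: "\<nu> \<in> space (prob_algebra (Z K))" and k: "k \<le> K"
    and f: "f \<in> borel_measurable (Z k)"
    and b: "\<And>z. z \<in> space (Z k) \<Longrightarrow> \<bar>f z\<bar> \<le> B"
  shows "(\<integral>\<omega>. f (\<omega> k) \<partial>latent_chain Z K \<nu> T K) = (\<integral>\<omega>. f (\<omega> k) \<partial>latent_chain Z K \<nu> T (K - k))"
proof -
  have "(\<integral>\<omega>. f (\<omega> k) \<partial>latent_chain Z K \<nu> T j) = (\<integral>\<omega>. f (\<omega> k) \<partial>latent_chain Z K \<nu> T (K - k))"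
    if "K - k \<le> j" "j \<le> K" for j
    using that
  proof (induction rule: dec_induct)
    case (step j)
    then show ?case using integral_latent_chain_old[OF \<nu> _ _ f b, of j] k by auto
  qed simp
  from this[of K] show ?thesis by simp
qed

lemma integral_latent_chain_init:
  fixes f :: "'s \<Rightarrow> real"
  assumes \<nu>: "\<nu> \<in> space (prob_algebra (Z K))"
    and f: "f \<in> borel_measurable (Z K)"
    and b: "\<And>z. z \<in> space (Z K) \<Longrightarrow> \<bar>f z\<bar> \<le> B"
  shows "(\<integral>\<omega>. f (\<omega> K) \<partial>latent_chain Z K \<nu> T K) = (\<integral>z. f z \<partial>\<nu>)"
proof -
  have m: "(\<lambda>z. \<lambda>i\<in>{K..K}. z) \<in> \<nu> \<rightarrow>\<^sub>M Pi\<^sub>M {K..K} Z"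
    using latent_init_measurable space_prob_algebraD(1)[OF \<nu>] by (simp cong: measurable_cong_sets)
  have "(\<integral>\<omega>. f (\<omega> K) \<partial>latent_chain Z K \<nu> T K) = (\<integral>\<omega>. f (\<omega> K) \<partial>latent_chain Z K \<nu> T 0)"
    using integral_latent_chain_coord[OF \<nu> _ f b] by simp
  also have "\<dots> = (\<integral>z. f ((\<lambda>i\<in>{K..K}. z) K) \<partial>\<nu>)"
    unfolding latent_chain.simps
    by (rule integral_distr[OF m]) (auto intro!: measurable_apply_component[where M=Z, OF f])
  finally show ?thesis by simp
qed

text \<open>The Markov property in integrated form. It is read off at the step that draws coordinate
  \<open>k - 1\<close>; both sides are then carried to the full chain, the right one as the
  expectation of a function of coordinate \<open>k\<close>.\<close>

lemma integral_latent_chain_step: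
  fixes f :: "'s \<Rightarrow> real"
  assumes \<nu>: "\<nu> \<in> space (prob_algebra (Z K))" and k: "k \<in> {1..K}"
    and f: "f \<in> borel_measurable (Z (k - 1))"
    and b: "\<And>z. z \<in> space (Z (k - 1)) \<Longrightarrow> \<bar>f z\<bar> \<le> B"
  shows "(\<integral>\<omega>. f (\<omega> (k - 1)) \<partial>latent_chain Z K \<nu> T K) =
    (\<integral>\<omega>. \<integral>z. f z \<partial>T k (\<omega> k) \<partial>latent_chain Z K \<nu> T K)"
proof -
  \<comment> \<open>Coordinate \<open>k - 1\<close> is drawn by the step from \<open>K - k\<close>
    to \<open>Suc (K - k)\<close>; \<open>1 \<le> k \<le> K\<close> keeps the truncated subtractions
    exact.\<close>
  have e: "K - Suc (K - k) = k - 1" "Suc (K - k) = K - (k - 1)" "K - (K - k) = k" "Suc (K - k) \<le> K"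
    using k by auto
  have "(\<integral>\<omega>. f (\<omega> (k - 1)) \<partial>latent_chain Z K \<nu> T K)
      = (\<integral>\<omega>. f (\<omega> (k - 1)) \<partial>latent_chain Z K \<nu> T (K - (k - 1)))"
    using k by (intro integral_latent_chain_coord[OF \<nu> _ f b]) auto
  also have "\<dots> = (\<integral>\<omega>. \<integral>z. f z \<partial>T k (\<omega> k) \<partial>latent_chain Z K \<nu> T (K - k))"
    using integral_latent_chain_new[OF \<nu> e(4), of f B] f b unfolding e(1) e(2)[symmetric] e(3) by auto
  also have "\<dots> = (\<integral>\<omega>. \<integral>z. f z \<partial>T k (\<omega> k) \<partial>latent_chain Z K \<nu> T K)"
  proof (rule integral_latent_chain_coord[OF \<nu>, symmetric, where B=B])
    show "(\<lambda>z. \<integral>z. f z \<partial>T k z) \<in> borel_measurable (Z k)"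
      by (rule kernel_integral_measurable[OF T[OF k] f])
    show "\<bar>\<integral>z. f z \<partial>T k z\<bar> \<le> B" if "z \<in> space (Z k)" for z
      by (rule prob_algebra_abs_integral_le[OF measurable_space[OF T[OF k] that] b])
  qed (use k in auto)
  finally show ?thesis .
qed

text \<open>A discrete Dynkin formula: the difference of the two ends is a telescoping sum, in which
  the Markov property replaces each expectation of \<open>f (k - 1)\<close> by that of its
  conditional mean given coordinate \<open>k\<close>. Integrability is recorded because the sum is
  later compared pointwise with divergences.\<close>

lemma integral_latent_chain_telescope:
  fixes f :: "nat \<Rightarrow> 's \<Rightarrow> real"
  assumes \<nu>: "\<nu> \<in> space (prob_algebra (Z K))"
    and f: "\<And>k. k \<le> K \<Longrightarrow> f k \<in> borel_measurable (Z k)"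
    and b: "\<And>k z. k \<le> K \<Longrightarrow> z \<in> space (Z k) \<Longrightarrow> \<bar>f k z\<bar> \<le> B"
  shows "(\<integral>\<omega>. f 0 (\<omega> 0) \<partial>latent_chain Z K \<nu> T K) - (\<integral>z. f K z \<partial>\<nu>) =
      (\<integral>\<omega>. (\<Sum>k=1..K. (\<integral>z. f (k - 1) z \<partial>T k (\<omega> k)) - f k (\<omega> k)) \<partial>latent_chain Z K \<nu> T K)" (is ?eq)
    and "integrable (latent_chain Z K \<nu> T K)
      (\<lambda>\<omega>. \<Sum>k=1..K. (\<integral>z. f (k - 1) z \<partial>T k (\<omega> k)) - f k (\<omega> k))" (is ?int)
proof -
  let ?L = "latent_chain Z K \<nu> T K"
  have L: "?L \<in> space (prob_algebra (Pi\<^sub>M {0..K} Z))"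
    using latent_chain_in[OF \<nu>, of K] by simp
  have i: "integrable ?L (\<lambda>\<omega>. g (\<omega> k))"
    if "k \<le> K" "g \<in> borel_measurable (Z k)" "\<And>z. z \<in> space (Z k) \<Longrightarrow> \<bar>g z\<bar> \<le> B" for k and g :: "'s \<Rightarrow> real"
  proof (rule prob_algebra_integrable[OF L, where B=B])
    have k': "k \<in> {0..K}" using that by simp
    show "(\<lambda>\<omega>. g (\<omega> k)) \<in> borel_measurable (Pi\<^sub>M {0..K} Z)"
      by (rule measurable_apply_component[where M=Z, OF that(2) k'])
    show "\<bar>g (\<omega> k)\<bar> \<le> B" if "\<omega> \<in> space (Pi\<^sub>M {0..K} Z)" for \<omega>
      by (rule \<open>\<And>z. z \<in> space (Z k) \<Longrightarrow> \<bar>g z\<bar> \<le> B\<close>[OF space_PiM_component[OF that k']])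
  qed
  have i1: "integrable ?L (\<lambda>\<omega>. f k (\<omega> k))" if "k \<le> K" for k
    by (rule i) (use that f b in auto)
  have i2: "integrable ?L (\<lambda>\<omega>. \<integral>z. f (k - 1) z \<partial>T k (\<omega> k))" if k: "k \<in> {1..K}" for k
  proof (rule i[of k "\<lambda>y. \<integral>z. f (k - 1) z \<partial>T k y"])
    show "(\<lambda>y. \<integral>z. f (k - 1) z \<partial>T k y) \<in> borel_measurable (Z k)"
      by (rule kernel_integral_measurable[OF T[OF k] f]) (use k in auto)
    show "\<bar>\<integral>z. f (k - 1) z \<partial>T k z\<bar> \<le> B" if "z \<in> space (Z k)" for z
      by (rule prob_algebra_abs_integral_le[OF measurable_space[OF T[OF k] that] b]) (use k in auto)
  qed (use k in auto)
  show ?int using i1 i2 by (intro Bochner_Integration.integrable_sum Bochner_Integration.integrable_diff) auto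
  have "(\<integral>\<omega>. (\<Sum>k=1..K. (\<integral>z. f (k - 1) z \<partial>T k (\<omega> k)) - f k (\<omega> k)) \<partial>?L)
      = (\<Sum>k=1..K. \<integral>\<omega>. ((\<integral>z. f (k - 1) z \<partial>T k (\<omega> k)) - f k (\<omega> k)) \<partial>?L)"
    using i1 i2 by (intro Bochner_Integration.integral_sum Bochner_Integration.integrable_diff) auto
  also have "\<dots> = (\<Sum>k=1..K. (\<integral>\<omega>. f (k - 1) (\<omega> (k - 1)) \<partial>?L) - (\<integral>\<omega>. f k (\<omega> k) \<partial>?L))"
  proof (rule sum.cong[OF refl])
    fix k assume k: "k \<in> {1..K}"
    have "(\<integral>\<omega>. f (k - 1) (\<omega> (k - 1)) \<partial>?L) = (\<integral>\<omega>. \<integral>z. f (k - 1) z \<partial>T k (\<omega> k) \<partial>?L)"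
      by (rule integral_latent_chain_step[OF \<nu> k f b]) (use k in auto)
    then show "(\<integral>\<omega>. ((\<integral>z. f (k - 1) z \<partial>T k (\<omega> k)) - f k (\<omega> k)) \<partial>?L)
        = (\<integral>\<omega>. f (k - 1) (\<omega> (k - 1)) \<partial>?L) - (\<integral>\<omega>. f k (\<omega> k) \<partial>?L)"
      using i1 i2 k by simp
  qed
  also have "\<dots> = (\<integral>\<omega>. f 0 (\<omega> 0) \<partial>?L) - (\<integral>\<omega>. f K (\<omega> K) \<partial>?L)"
  proof -
    have "(\<Sum>k=1..n. g (k - 1) - g k) = g 0 - g n" for n and g :: "nat \<Rightarrow> real"
      by (induction n) auto
    then show ?thesis by simp
  qed
  also have "(\<integral>\<omega>. f K (\<omega> K) \<partial>?L) = (\<integral>z. f K z \<partial>\<nu>)"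
    by (rule integral_latent_chain_init[OF \<nu> f b]) auto
  finally show ?eq by simp
qed

end

section \<open>Laws of the next state given a latent state\<close>

text \<open>\<open>terminal_law S T k z\<close> is the law of \<open>s'\<^sub>0\<close> given \<open>s'\<^sub>k = z\<close>.\<close>

primrec terminal_law :: "'s measure \<Rightarrow> (nat \<Rightarrow> 's \<Rightarrow> 's measure) \<Rightarrow> nat \<Rightarrow> 's \<Rightarrow> 's measure" where
  "terminal_law S T 0 = return S"
| "terminal_law S T (Suc k) = (\<lambda>z. T (Suc k) z \<bind> terminal_law S T k)"

lemma terminal_law_measurable:
  assumes T: "\<And>k. k \<in> {1..K} \<Longrightarrow> T k \<in> Z k \<rightarrow>\<^sub>M prob_algebra (Z (k - 1))"
  shows "k \<le> K \<Longrightarrow> terminal_law (Z 0) T k \<in> Z k \<rightarrow>\<^sub>M prob_algebra (Z 0)"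
proof (induction k)
  case 0
  then show ?case by simp
next
  case (Suc k)
  then show ?case
    using measurable_bind_prob_space[OF T[of "Suc k"]] by simp
qed

text \<open>Joint measurability is needed because \<open>(s, a)\<close> varies in the outer
  expectation; measurability in the latent state for each fixed \<open>(s, a)\<close> does not give
  it.\<close>

lemma terminal_law_measurable2:
  assumes T: "\<And>k. k \<in> {1..K} \<Longrightarrow> T k \<in> Z k \<Otimes>\<^sub>M X \<rightarrow>\<^sub>M prob_algebra (Z (k - 1))"
  shows "k \<le> K \<Longrightarrow> (\<lambda>(z, x). terminal_law (Z 0) (\<lambda>k z. T k (z, x)) k z) \<in> Z k \<Otimes>\<^sub>M X \<rightarrow>\<^sub>M prob_algebra (Z 0)"
proof (induction k)
  case 0
  have "(\<lambda>w. return (Z 0) (fst w)) \<in> Z 0 \<Otimes>\<^sub>M X \<rightarrow>\<^sub>M prob_algebra (Z 0)" by measurable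
  then show ?case by (simp add: case_prod_beta')
next
  case (Suc k)
  have IH: "(\<lambda>(z, x). terminal_law (Z 0) (\<lambda>k z. T k (z, x)) k z) \<in> Z k \<Otimes>\<^sub>M X \<rightarrow>\<^sub>M prob_algebra (Z 0)"
    using Suc by simp
  have Tk: "T (Suc k) \<in> Z (Suc k) \<Otimes>\<^sub>M X \<rightarrow>\<^sub>M prob_algebra (Z k)"
    using T[of "Suc k"] Suc.prems by simp
  \<comment> \<open>The remaining \<open>k\<close> steps are seen as a kernel depending on both
    \<open>w\<close>, which holds the earlier latent state and \<open>x\<close>, and the new state
    \<open>z\<close>. Only \<open>x\<close> is read from \<open>w\<close>.\<close>
  have "(\<lambda>(w, z). terminal_law (Z 0) (\<lambda>k z. T k (z, snd w)) k z)
      \<in> (Z (Suc k) \<Otimes>\<^sub>M X) \<Otimes>\<^sub>M Z k \<rightarrow>\<^sub>M prob_algebra (Z 0)"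
    using measurable_compose[OF _ IH, of "\<lambda>(w, z). (z, snd w)" "(Z (Suc k) \<Otimes>\<^sub>M X) \<Otimes>\<^sub>M Z k"]
    by (simp add: case_prod_beta')
  from measurable_bind_prob_space2[OF Tk this] show ?case
    by (simp add: case_prod_beta')
qed

lemma integral_terminal_law_Suc:
  fixes f :: "'s \<Rightarrow> real"
  assumes T: "\<And>k. k \<in> {1..K} \<Longrightarrow> T k \<in> Z k \<rightarrow>\<^sub>M prob_algebra (Z (k - 1))"
    and k: "k \<in> {1..K}" and z: "z \<in> space (Z k)"
    and f: "f \<in> borel_measurable (Z 0)" and b: "\<And>z. z \<in> space (Z 0) \<Longrightarrow> \<bar>f z\<bar> \<le> B"
  shows "(\<integral>y. f y \<partial>terminal_law (Z 0) T k z) = (\<integral>w. \<integral>y. f y \<partial>terminal_law (Z 0) T (k - 1) w \<partial>T k z)"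
proof -
  obtain m where m: "k = Suc m" using k by (cases k) auto
  show ?thesis
    using integral_bind_prob_algebra[OF measurable_space[OF T[OF k] z] _ f b,
        of "terminal_law (Z 0) T m"] terminal_law_measurable[where Z=Z, OF T, of K m] k
    by (simp add: m)
qed

text \<open>The conditional mean of \<open>V\<close> at the end of the chain, given coordinate
  \<open>k\<close>, is a martingale along the chain. Hence every increment in the telescoping
  formula vanishes.\<close>

lemma integral_latent_chain_terminal:
  fixes V :: "'s \<Rightarrow> real"
  assumes \<nu>: "\<nu> \<in> space (prob_algebra (Z K))"
    and T: "\<And>k. k \<in> {1..K} \<Longrightarrow> T k \<in> Z k \<rightarrow>\<^sub>M prob_algebra (Z (k - 1))"
    and V: "V \<in> borel_measurable (Z 0)" and b: "\<And>z. z \<in> space (Z 0) \<Longrightarrow> \<bar>V z\<bar> \<le> C"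
  shows "(\<integral>\<omega>. V (\<omega> 0) \<partial>latent_chain Z K \<nu> T K) = (\<integral>z. \<integral>y. V y \<partial>terminal_law (Z 0) T K z \<partial>\<nu>)"
proof -
  define f where "f k z = (\<integral>y. V y \<partial>terminal_law (Z 0) T k z)" for k z
  have tl: "terminal_law (Z 0) T k \<in> Z k \<rightarrow>\<^sub>M prob_algebra (Z 0)" if "k \<le> K" for k
    by (rule terminal_law_measurable[where Z=Z, OF T that])
  have fm: "f k \<in> borel_measurable (Z k)" if "k \<le> K" for k
    unfolding f_def by (rule kernel_integral_measurable[OF tl[OF that] V])
  have fb: "\<bar>f k z\<bar> \<le> C" if "k \<le> K" "z \<in> space (Z k)" for k z
    unfolding f_def by (rule prob_algebra_abs_integral_le[OF measurable_space[OF tl[OF that(1)] that(2)] b])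
  let ?L = "latent_chain Z K \<nu> T K"
  have L: "?L \<in> space (prob_algebra (Pi\<^sub>M {0..K} Z))"
    using latent_chain_in[where Z=Z, OF T \<nu>, of K] by simp
  have sp: "\<omega> k \<in> space (Z k)" if "\<omega> \<in> space ?L" "k \<le> K" for \<omega> k
    using space_PiM_component[of \<omega> "{0..K}" Z k] space_prob_algebraD(2)[OF L] that by auto
  have "(\<integral>\<omega>. f 0 (\<omega> 0) \<partial>?L) - (\<integral>z. f K z \<partial>\<nu>)
      = (\<integral>\<omega>. (\<Sum>k=1..K. (\<integral>z. f (k - 1) z \<partial>T k (\<omega> k)) - f k (\<omega> k)) \<partial>?L)"
    by (rule integral_latent_chain_telescope(1)[where Z=Z, OF T \<nu> fm fb])
  also have "\<dots> = (\<integral>\<omega>. 0 \<partial>?L)"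
  proof (intro Bochner_Integration.integral_cong refl sum.neutral ballI)
    fix \<omega> k assume w: "\<omega> \<in> space ?L" and k: "k \<in> {1..K}"
    then have "\<omega> k \<in> space (Z k)" using sp by auto
    then show "(\<integral>z. f (k - 1) z \<partial>T k (\<omega> k)) - f k (\<omega> k) = 0"
      unfolding f_def using integral_terminal_law_Suc[where Z=Z, OF T k _ V b] by auto
  qed
  also have "(\<integral>\<omega>. f 0 (\<omega> 0) \<partial>?L) = (\<integral>\<omega>. V (\<omega> 0) \<partial>?L)"
    by (intro Bochner_Integration.integral_cong refl)
      (auto simp: f_def integral_return[OF sp V])
  finally show ?thesis by (simp add: f_def)
qed

section \<open>Transport along the chain and the one-step gap\<close>

text \<open>Both chains start from the same law \<open>\<nu>\<close>, so only the transitions are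
  compared. With \<open>W k\<close> the log-Laplace transform under \<open>T'\<close>,
  \<open>exp (W k)\<close> is the \<open>T' k\<close>-mean of \<open>exp (W (k - 1))\<close>;
  Donsker-Varadhan therefore bounds the \<open>k\<close>-th increment of \<open>W\<close> by the
  \<open>k\<close>-th divergence.\<close>

lemma latent_chain_KL_transport:
  fixes V :: "'s \<Rightarrow> real"
  assumes \<nu>: "\<nu> \<in> space (prob_algebra (Z K))"
    and T: "\<And>k. k \<in> {1..K} \<Longrightarrow> T k \<in> Z k \<rightarrow>\<^sub>M prob_algebra (Z (k - 1))"
    and T': "\<And>k. k \<in> {1..K} \<Longrightarrow> T' k \<in> Z k \<rightarrow>\<^sub>M prob_algebra (Z (k - 1))"
    and V: "V \<in> borel_measurable (Z 0)" and b: "\<And>z. z \<in> space (Z 0) \<Longrightarrow> \<bar>V z\<bar> \<le> C"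
    and C: "C > 0"
  shows "ennreal ((\<integral>\<omega>. V (\<omega> 0) \<partial>latent_chain Z K \<nu> T K) - (\<integral>z. \<integral>y. V y \<partial>terminal_law (Z 0) T' K z \<partial>\<nu>))
    \<le> ennreal (sqrt 2 * C) * ennreal_sqrt
       (\<integral>\<^sup>+\<omega>. (\<Sum>k=1..K. KL_div (T k (\<omega> k)) (T' k (\<omega> k))) \<partial>latent_chain Z K \<nu> T K)"
proof (rule le_ennreal_sqrtI[OF C])
  fix l :: real assume l: "l > 0"
  let ?L = "latent_chain Z K \<nu> T K"
  have L: "?L \<in> space (prob_algebra (Pi\<^sub>M {0..K} Z))"
    using latent_chain_in[where Z=Z, OF T \<nu>, of K] by simp
  have sp: "\<omega> k \<in> space (Z k)" if "\<omega> \<in> space ?L" "k \<le> K" for \<omega> k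
    using space_PiM_component[of \<omega> "{0..K}" Z k] space_prob_algebraD(2)[OF L] that by auto
  define W where "W k z = ln (\<integral>y. exp (l * V y) \<partial>terminal_law (Z 0) T' k z)" for k z
  have tl: "terminal_law (Z 0) T' k \<in> Z k \<rightarrow>\<^sub>M prob_algebra (Z 0)" if "k \<le> K" for k
    by (rule terminal_law_measurable[where Z=Z, OF T' that])
  have lV: "(\<lambda>y. l * V y) \<in> borel_measurable (Z 0)"
    and eV: "(\<lambda>y. exp (l * V y)) \<in> borel_measurable (Z 0)" using V by measurable
  have lb: "\<bar>l * V y\<bar> \<le> l * C" if "y \<in> space (Z 0)" for y
    using b[OF that] l by (simp add: abs_mult)
  have eb: "\<bar>exp (l * V y)\<bar> \<le> exp (l * C)" if "y \<in> space (Z 0)" for y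
    using lb[OF that] by simp
  have mgf: "exp (- (l * C)) \<le> (\<integral>y. exp (l * V y) \<partial>terminal_law (Z 0) T' k z)"
    "(\<integral>y. exp (l * V y) \<partial>terminal_law (Z 0) T' k z) \<le> exp (l * C)"
    "0 < (\<integral>y. exp (l * V y) \<partial>terminal_law (Z 0) T' k z)"
    if "k \<le> K" "z \<in> space (Z k)" for k z
    using prob_algebra_integral_exp[OF measurable_space[OF tl[OF that(1)] that(2)] lV lb]
      less_le_trans[OF exp_gt_zero] by blast+
  have Wm: "W k \<in> borel_measurable (Z k)" if "k \<le> K" for k
    unfolding W_def using kernel_integral_measurable[OF tl[OF that] eV] by measurable
  have Wb: "\<bar>W k z\<bar> \<le> l * C" if "k \<le> K" "z \<in> space (Z k)" for k z
    using mgf[OF that] ln_ge_iff[OF mgf(3)[OF that], of "- (l * C)"]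
      ln_le_cancel_iff[OF mgf(3)[OF that] exp_gt_zero, of "l * C"]
    unfolding W_def by auto
  define D where "D \<omega> = (\<Sum>k=1..K. (\<integral>z. W (k - 1) z \<partial>T k (\<omega> k)) - W k (\<omega> k))" for \<omega>
  have tele: "(\<integral>\<omega>. W 0 (\<omega> 0) \<partial>?L) - (\<integral>z. W K z \<partial>\<nu>) = (\<integral>\<omega>. D \<omega> \<partial>?L)"
    unfolding D_def by (rule integral_latent_chain_telescope(1)[where Z=Z, OF T \<nu> Wm Wb])
  have iD: "integrable ?L D"
    unfolding D_def by (rule integral_latent_chain_telescope(2)[where Z=Z, OF T \<nu> Wm Wb])
  \<comment> \<open>\<open>terminal_law (Z 0) T' 0\<close> is a Dirac measure, so \<open>W 0\<close>
    is just \<open>l * V\<close>.\<close>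
  have W0: "(\<integral>\<omega>. W 0 (\<omega> 0) \<partial>?L) = l * (\<integral>\<omega>. V (\<omega> 0) \<partial>?L)"
  proof -
    have "(\<integral>\<omega>. W 0 (\<omega> 0) \<partial>?L) = (\<integral>\<omega>. l * V (\<omega> 0) \<partial>?L)"
      by (intro Bochner_Integration.integral_cong refl)
        (auto simp: W_def integral_return[OF sp eV])
    then show ?thesis by simp
  qed
  \<comment> \<open>Hoeffding's bound enters only here, at the start of the chain. The quadratic
    error is thus paid once and not in each of the \<open>K\<close> transitions.\<close>
  have WK: "(\<integral>z. W K z \<partial>\<nu>) \<le> l * (\<integral>z. \<integral>y. V y \<partial>terminal_law (Z 0) T' K z \<partial>\<nu>) + l\<^sup>2 * C\<^sup>2 / 2"
  proof -
    interpret nu: prob_space \<nu> using space_prob_algebraD(3)[OF \<nu>] .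
    let ?g = "\<lambda>z. \<integral>y. V y \<partial>terminal_law (Z 0) T' K z"
    have gi: "integrable \<nu> ?g"
      by (rule prob_algebra_integrable[OF \<nu> kernel_integral_measurable[OF tl V]])
        (auto intro: prob_algebra_abs_integral_le[OF measurable_space[OF tl] b])
    have "(\<integral>z. W K z \<partial>\<nu>) \<le> (\<integral>z. l * ?g z + l\<^sup>2 * C\<^sup>2 / 2 \<partial>\<nu>)"
    proof (rule integral_mono)
      show "integrable \<nu> (W K)" by (rule prob_algebra_integrable[OF \<nu> Wm Wb]) auto
      show "integrable \<nu> (\<lambda>z. l * ?g z + l\<^sup>2 * C\<^sup>2 / 2)" using gi by simp
      show "W K z \<le> l * ?g z + l\<^sup>2 * C\<^sup>2 / 2" if "z \<in> space \<nu>" for z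
        unfolding W_def using that space_prob_algebraD(2)[OF \<nu>]
        by (intro ln_mgf_le[OF measurable_space[OF tl[OF order_refl]] V b l]) auto
    qed
    also have "\<dots> = l * (\<integral>z. ?g z \<partial>\<nu>) + l\<^sup>2 * C\<^sup>2 / 2"
      using gi by (simp add: nu.prob_space)
    finally show ?thesis .
  qed
  have "l * ((\<integral>\<omega>. V (\<omega> 0) \<partial>?L) - (\<integral>z. \<integral>y. V y \<partial>terminal_law (Z 0) T' K z \<partial>\<nu>)) - l\<^sup>2 * C\<^sup>2 / 2
      \<le> (\<integral>\<omega>. D \<omega> \<partial>?L)"
    using tele W0 WK by (simp add: algebra_simps)
  \<comment> \<open>The increments may be negative while divergences take values in
    \<open>[0, \<infinity>]\<close>. The positive part permits a pointwise comparison under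
    \<open>nn_integral\<close>, which is monotone also for a non-measurable upper function.\<close>
  also have "(\<integral>\<omega>. D \<omega> \<partial>?L) \<le> (\<integral>\<omega>. max 0 (D \<omega>) \<partial>?L)"
    using iD by (intro integral_mono) auto
  finally have "ennreal (l * ((\<integral>\<omega>. V (\<omega> 0) \<partial>?L) - (\<integral>z. \<integral>y. V y \<partial>terminal_law (Z 0) T' K z \<partial>\<nu>)) - l\<^sup>2 * C\<^sup>2 / 2)
      \<le> ennreal (\<integral>\<omega>. max 0 (D \<omega>) \<partial>?L)" by (rule ennreal_leI)
  also have "\<dots> = (\<integral>\<^sup>+\<omega>. ennreal (max 0 (D \<omega>)) \<partial>?L)"
    using iD by (intro nn_integral_eq_integral[symmetric]) auto
  also have "\<dots> \<le> (\<integral>\<^sup>+\<omega>. (\<Sum>k=1..K. KL_div (T k (\<omega> k)) (T' k (\<omega> k))) \<partial>?L)"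
  proof (rule nn_integral_mono)
    fix \<omega> assume w: "\<omega> \<in> space ?L"
    let ?d = "\<lambda>k. (\<integral>z. W (k - 1) z \<partial>T k (\<omega> k)) - W k (\<omega> k)"
    have "ennreal (max 0 (D \<omega>)) \<le> ennreal (\<Sum>k=1..K. max 0 (?d k))"
      unfolding D_def by (intro ennreal_leI) (auto intro!: sum_nonneg sum_mono)
    also have "\<dots> = (\<Sum>k=1..K. ennreal (max 0 (?d k)))" by (rule sum_ennreal[symmetric]) auto
    also have "\<dots> \<le> (\<Sum>k=1..K. KL_div (T k (\<omega> k)) (T' k (\<omega> k)))"
    proof (rule sum_mono)
      fix k assume k: "k \<in> {1..K}"
      have z: "\<omega> k \<in> space (Z k)" using sp[OF w, of k] k by simp
      have k1: "k - 1 \<le> K" using k by auto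
      \<comment> \<open>Positivity of the moment generating function cancels \<open>exp\<close>
        against \<open>ln\<close>; the tower property then identifies \<open>W k\<close> as the
        log-moment term in Donsker-Varadhan for \<open>W (k - 1)\<close>.\<close>
      have "(\<integral>w. exp (W (k - 1) w) \<partial>T' k (\<omega> k))
          = (\<integral>w. \<integral>y. exp (l * V y) \<partial>terminal_law (Z 0) T' (k - 1) w \<partial>T' k (\<omega> k))"
        using space_prob_algebraD(2)[OF measurable_space[OF T'[OF k] z]] mgf(3)[OF k1]
        by (intro Bochner_Integration.integral_cong refl) (auto simp: W_def)
      also have "\<dots> = (\<integral>y. exp (l * V y) \<partial>terminal_law (Z 0) T' k (\<omega> k))"
        by (rule integral_terminal_law_Suc[where Z=Z, OF T' k z eV eb, symmetric])
      finally have e: "W k (\<omega> k) = ln (\<integral>w. exp (W (k - 1) w) \<partial>T' k (\<omega> k))"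
        by (simp add: W_def)
      have "ennreal (?d k) \<le> KL_div (T k (\<omega> k)) (T' k (\<omega> k))"
        unfolding e
        by (rule Donsker_Varadhan[OF measurable_space[OF T[OF k] z] measurable_space[OF T'[OF k] z]
              Wm[OF k1] Wb[OF k1]])
      then show "ennreal (max 0 (?d k)) \<le> KL_div (T k (\<omega> k)) (T' k (\<omega> k))"
        by (simp add: max_def ennreal_neg)
    qed
    finally show "ennreal (max 0 (D \<omega>)) \<le> (\<Sum>k=1..K. KL_div (T k (\<omega> k)) (T' k (\<omega> k)))" .
  qed
  finally show "ennreal (l * ((\<integral>\<omega>. V (\<omega> 0) \<partial>?L) - (\<integral>z. \<integral>y. V y \<partial>terminal_law (Z 0) T' K z \<partial>\<nu>)) - l\<^sup>2 * C\<^sup>2 / 2)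
      \<le> (\<integral>\<^sup>+\<omega>. (\<Sum>k=1..K. KL_div (T k (\<omega> k)) (T' k (\<omega> k))) \<partial>?L)" .
qed

text \<open>\<open>g1\<close> changes the law of the initial latent state and keeps the target
  transitions; \<open>g2\<close> changes the transitions and keeps the source initial law.
  Measurability and boundedness are asserted for \<open>g1\<close> only, since \<open>g2\<close>
  inherits its integrability from the total gap.\<close>

lemma generative_trajectory_gap:
  fixes V :: "'s \<Rightarrow> real"
  assumes src: "is_generative_trajectory S A Z K P \<nu> T"
    and tar: "is_generative_trajectory S A Z K P' \<nu>' T'"
    and V: "V \<in> borel_measurable S" and b: "\<And>s. s \<in> space S \<Longrightarrow> \<bar>V s\<bar> \<le> C" and C: "C > 0"
  shows "\<exists>g1 g2. g1 \<in> borel_measurable (S \<Otimes>\<^sub>M A) \<and> (\<forall>x\<in>space (S \<Otimes>\<^sub>M A).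
    \<bar>g1 x\<bar> \<le> 2 * C \<and> (\<integral>y. V y \<partial>P x) - (\<integral>y. V y \<partial>P' x) = g1 x + g2 x \<and>
    ennreal (g1 x) \<le> ennreal (sqrt 2 * C) *
      ennreal_sqrt (\<integral>\<^sup>+\<omega>. KL_div (\<nu> x) (\<nu>' x) \<partial>trajectory Z K \<nu> T x) \<and>
    ennreal (g2 x) \<le> ennreal (sqrt 2 * C) * ennreal_sqrt
      (\<integral>\<^sup>+\<omega>. (\<Sum>k=1..K. KL_div (T k (\<omega> k, x)) (T' k (\<omega> k, x))) \<partial>trajectory Z K \<nu> T x))"
proof -
  let ?X = "S \<Otimes>\<^sub>M A"
  have Z0: "Z 0 = S" using src by (simp add: is_generative_trajectory_def)
  have n: "\<nu> \<in> ?X \<rightarrow>\<^sub>M prob_algebra (Z K)" "\<nu>' \<in> ?X \<rightarrow>\<^sub>M prob_algebra (Z K)"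
    using src tar by (auto simp: is_generative_trajectory_def)
  have Tm: "T k \<in> Z k \<Otimes>\<^sub>M ?X \<rightarrow>\<^sub>M prob_algebra (Z (k - 1))"
    "T' k \<in> Z k \<Otimes>\<^sub>M ?X \<rightarrow>\<^sub>M prob_algebra (Z (k - 1))" if "k \<in> {1..K}" for k
    using src tar that by (auto simp: is_generative_trajectory_def)
  have Tx: "(\<lambda>z. T k (z, x)) \<in> Z k \<rightarrow>\<^sub>M prob_algebra (Z (k - 1))"
    "(\<lambda>z. T' k (z, x)) \<in> Z k \<rightarrow>\<^sub>M prob_algebra (Z (k - 1))" if "x \<in> space ?X" "k \<in> {1..K}" for k x
    using measurable_compose[OF measurable_Pair2'[OF that(1)]] Tm[OF that(2)] by auto
  have VZ: "V \<in> borel_measurable (Z 0)" and bZ: "\<And>z. z \<in> space (Z 0) \<Longrightarrow> \<bar>V z\<bar> \<le> C"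
    using V b by (auto simp: Z0)
  define v where "v x z = (\<integral>y. V y \<partial>terminal_law (Z 0) (\<lambda>k z. T' k (z, x)) K z)" for x z
  have tl: "terminal_law (Z 0) (\<lambda>k z. T' k (z, x)) K \<in> Z K \<rightarrow>\<^sub>M prob_algebra (Z 0)" if "x \<in> space ?X" for x
    by (rule terminal_law_measurable[where Z=Z and K=K]) (use Tx that in auto)
  have vm: "v x \<in> borel_measurable (Z K)" if "x \<in> space ?X" for x
    unfolding v_def by (rule kernel_integral_measurable[OF tl[OF that] VZ])
  have vb: "\<bar>v x z\<bar> \<le> C" if "x \<in> space ?X" "z \<in> space (Z K)" for x z
    unfolding v_def by (rule prob_algebra_abs_integral_le[OF measurable_space[OF tl[OF that(1)] that(2)] bZ])
  \<comment> \<open>Joint measurability of \<open>v\<close>, followed by a swap of its arguments,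
    makes its integral against a kernel in \<open>x\<close> a measurable function of
    \<open>x\<close>.\<close>
  have "(\<lambda>(z, x). v x z) \<in> borel_measurable (Z K \<Otimes>\<^sub>M ?X)"
    using kernel_integral_measurable[OF terminal_law_measurable2[where Z=Z, OF Tm(2) order_refl] VZ]
    by (simp add: v_def case_prod_beta')
  then have v2: "(\<lambda>(x, z). v x z) \<in> borel_measurable (?X \<Otimes>\<^sub>M Z K)"
    using measurable_compose[OF measurable_pair_swap', of "\<lambda>(z, x). v x z" "Z K" ?X borel]
    by (simp add: case_prod_beta')
  have int_v: "(\<lambda>x. \<integral>z. v x z \<partial>N x) \<in> borel_measurable ?X" if N: "N \<in> ?X \<rightarrow>\<^sub>M prob_algebra (Z K)" for N
    using kernel_integral_measurable2(1)[OF N v2] by simp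
  define g1 where "g1 x = (\<integral>z. v x z \<partial>\<nu> x) - (\<integral>z. v x z \<partial>\<nu>' x)" for x
  define g2 where "g2 x = (\<integral>\<omega>. V (\<omega> 0) \<partial>trajectory Z K \<nu> T x) - (\<integral>z. v x z \<partial>\<nu> x)" for x
  have traj: "trajectory Z K N U x \<in> space (prob_algebra (Pi\<^sub>M {0..K} Z))"
    if "N x \<in> space (prob_algebra (Z K))" "\<And>k. k \<in> {1..K} \<Longrightarrow> (\<lambda>z. U k (z, x)) \<in> Z k \<rightarrow>\<^sub>M prob_algebra (Z (k - 1))"
    for N U and x :: "'s \<times> 'b"
    unfolding trajectory_def
    using latent_chain_in[where Z=Z and T="\<lambda>k z. U k (z, x)", OF that(2,1), of K] by simp
  have marg: "(\<integral>y. V y \<partial>distr (trajectory Z K N U x) (Z 0) (\<lambda>\<omega>. \<omega> 0)) = (\<integral>\<omega>. V (\<omega> 0) \<partial>trajectory Z K N U x)"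
    if "N x \<in> space (prob_algebra (Z K))" "\<And>k. k \<in> {1..K} \<Longrightarrow> (\<lambda>z. U k (z, x)) \<in> Z k \<rightarrow>\<^sub>M prob_algebra (Z (k - 1))"
    for N U and x :: "'s \<times> 'b"
  proof (rule integral_distr[OF _ VZ])
    show "(\<lambda>\<omega>. \<omega> 0) \<in> trajectory Z K N U x \<rightarrow>\<^sub>M Z 0"
      using measurable_component_singleton[of 0 "{0..K}" Z] space_prob_algebraD(1)[OF traj[of N x U, OF that]]
      by (simp cong: measurable_cong_sets)
  qed
  show ?thesis
  proof (rule exI[of _ g1], rule exI[of _ g2], intro conjI ballI)
    show "g1 \<in> borel_measurable ?X"
      unfolding g1_def using int_v[OF n(1)] int_v[OF n(2)] by (rule borel_measurable_diff)
  next
    fix x assume x: "x \<in> space ?X"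
    note nx = measurable_space[OF n(1) x] measurable_space[OF n(2) x]
    show "\<bar>g1 x\<bar> \<le> 2 * C"
      using prob_algebra_abs_integral_le[OF nx(1) vb[OF x]] prob_algebra_abs_integral_le[OF nx(2) vb[OF x]]
      unfolding g1_def by fastforce
    have "P x = distr (trajectory Z K \<nu> T x) (Z 0) (\<lambda>\<omega>. \<omega> 0)"
      "P' x = distr (trajectory Z K \<nu>' T' x) (Z 0) (\<lambda>\<omega>. \<omega> 0)"
      using src tar x by (auto simp: is_generative_trajectory_def)
    moreover have "(\<integral>\<omega>. V (\<omega> 0) \<partial>trajectory Z K \<nu>' T' x) = (\<integral>z. v x z \<partial>\<nu>' x)"
      unfolding trajectory_def v_def
      by (rule integral_latent_chain_terminal[where Z=Z, OF nx(2) Tx(2)[OF x] VZ bZ])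
    ultimately show "(\<integral>y. V y \<partial>P x) - (\<integral>y. V y \<partial>P' x) = g1 x + g2 x"
      using marg[of \<nu> x T, OF nx(1) Tx(1)[OF x]]
        marg[of \<nu>' x T', OF nx(2) Tx(2)[OF x]] by (simp add: g1_def g2_def)
    interpret tr: prob_space "trajectory Z K \<nu> T x"
      using space_prob_algebraD(3)[OF traj[of \<nu> x T, OF nx(1) Tx(1)[OF x]]] .
    \<comment> \<open>The divergence does not depend on the trajectory, which has mass one, so its
      expectation is the divergence itself.\<close>
    show "ennreal (g1 x)
      \<le> ennreal (sqrt 2 * C) * ennreal_sqrt (\<integral>\<^sup>+\<omega>. KL_div (\<nu> x) (\<nu>' x) \<partial>trajectory Z K \<nu> T x)"
      using KL_transport[OF nx vm[OF x] vb[OF x] C] by (simp add: g1_def tr.emeasure_space_1)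
    show "ennreal (g2 x)
      \<le> ennreal (sqrt 2 * C) * ennreal_sqrt
       (\<integral>\<^sup>+\<omega>. (\<Sum>k=1..K. KL_div (T k (\<omega> k, x)) (T' k (\<omega> k, x))) \<partial>trajectory Z K \<nu> T x)"
      unfolding g2_def v_def trajectory_def
      by (rule latent_chain_KL_transport[where Z=Z, OF nx(1) Tx[OF x] VZ bZ C])
  qed
qed

section \<open>Visitation and value iteration\<close>

context
  fixes S :: "'s measure" and A :: "'a measure" and \<mu> :: "'s measure"
    and P :: "'s \<times> 'a \<Rightarrow> 's measure" and \<pi> :: "'s \<Rightarrow> 'a measure"
  assumes \<mu>: "\<mu> \<in> space (prob_algebra S)"
    and P: "P \<in> S \<Otimes>\<^sub>M A \<rightarrow>\<^sub>M prob_algebra S"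
    and \<pi>: "\<pi> \<in> S \<rightarrow>\<^sub>M prob_algebra A"
begin

lemma policy_step_measurable:
  "(\<lambda>s. \<pi> s \<bind> (\<lambda>a. P (s, a))) \<in> S \<rightarrow>\<^sub>M prob_algebra S"
  using measurable_bind_prob_space2[OF \<pi>, of "\<lambda>s a. P (s, a)" S] P by simp

lemma policy_pair_measurable:
  "(\<lambda>s. distr (\<pi> s) (S \<Otimes>\<^sub>M A) (\<lambda>a. (s, a))) \<in> S \<rightarrow>\<^sub>M prob_algebra (S \<Otimes>\<^sub>M A)"
  by (rule measurable_distr_prob_space2[OF \<pi>]) measurable

lemma state_dist_in: "state_dist \<mu> P \<pi> t \<in> space (prob_algebra S)"
  by (induction t) (use \<mu> bind_in_prob_algebra[OF _ policy_step_measurable] in auto)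

lemma state_action_dist_in: "state_action_dist S A \<mu> P \<pi> t \<in> space (prob_algebra (S \<Otimes>\<^sub>M A))"
  unfolding state_action_dist_def by (rule bind_in_prob_algebra[OF state_dist_in policy_pair_measurable])

lemma integral_state_action_dist:
  fixes F :: "'s \<times> 'a \<Rightarrow> real"
  assumes F: "F \<in> borel_measurable (S \<Otimes>\<^sub>M A)" and b: "\<And>x. x \<in> space (S \<Otimes>\<^sub>M A) \<Longrightarrow> \<bar>F x\<bar> \<le> B"
  shows "(\<integral>x. F x \<partial>state_action_dist S A \<mu> P \<pi> t) = (\<integral>s. \<integral>a. F (s, a) \<partial>\<pi> s \<partial>state_dist \<mu> P \<pi> t)"
proof -
  have "(\<integral>x. F x \<partial>state_action_dist S A \<mu> P \<pi> t)
    = (\<integral>s. \<integral>x. F x \<partial>distr (\<pi> s) (S \<Otimes>\<^sub>M A) (\<lambda>a. (s, a)) \<partial>state_dist \<mu> P \<pi> t)"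
    unfolding state_action_dist_def
    by (rule integral_bind_prob_algebra[OF state_dist_in policy_pair_measurable F b])
  also have "\<dots> = (\<integral>s. \<integral>a. F (s, a) \<partial>\<pi> s \<partial>state_dist \<mu> P \<pi> t)"
    using space_prob_algebraD(2)[OF state_dist_in]
    by (intro Bochner_Integration.integral_cong refl kernel_integral_measurable2(2)[OF \<pi> F]) auto
  finally show ?thesis .
qed

lemma integral_state_action_dist_fst:
  fixes g :: "'s \<Rightarrow> real"
  assumes g: "g \<in> borel_measurable S" and b: "\<And>s. s \<in> space S \<Longrightarrow> \<bar>g s\<bar> \<le> B"
  shows "(\<integral>x. g (fst x) \<partial>state_action_dist S A \<mu> P \<pi> t) = (\<integral>s. g s \<partial>state_dist \<mu> P \<pi> t)"
proof -
  have m: "(\<lambda>x. g (fst x)) \<in> borel_measurable (S \<Otimes>\<^sub>M A)" using g by measurable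
  have "(\<integral>x. g (fst x) \<partial>state_action_dist S A \<mu> P \<pi> t) = (\<integral>s. \<integral>a. g s \<partial>\<pi> s \<partial>state_dist \<mu> P \<pi> t)"
    using integral_state_action_dist[OF m, of B] b by (auto simp: space_pair_measure)
  also have "\<dots> = (\<integral>s. g s \<partial>state_dist \<mu> P \<pi> t)"
  proof (intro Bochner_Integration.integral_cong refl)
    fix s assume "s \<in> space (state_dist \<mu> P \<pi> t)"
    then have s: "s \<in> space S" using space_prob_algebraD(2)[OF state_dist_in] by simp
    interpret prob_space "\<pi> s" using space_prob_algebraD(3)[OF measurable_space[OF \<pi> s]] .
    show "(\<integral>a. g s \<partial>\<pi> s) = g s" by (simp add: prob_space)
  qed
  finally show ?thesis .
qed

lemma integral_state_dist_Suc:
  fixes g :: "'s \<Rightarrow> real"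
  assumes g: "g \<in> borel_measurable S" and b: "\<And>s. s \<in> space S \<Longrightarrow> \<bar>g s\<bar> \<le> B"
  shows "(\<integral>s. g s \<partial>state_dist \<mu> P \<pi> (Suc t)) = (\<integral>x. \<integral>s. g s \<partial>P x \<partial>state_action_dist S A \<mu> P \<pi> t)"
proof -
  have "(\<integral>s. g s \<partial>state_dist \<mu> P \<pi> (Suc t))
      = (\<integral>s. \<integral>s'. g s' \<partial>(\<pi> s \<bind> (\<lambda>a. P (s, a))) \<partial>state_dist \<mu> P \<pi> t)"
    unfolding state_dist.simps by (rule integral_bind_prob_algebra[OF state_dist_in policy_step_measurable g b])
  also have "\<dots> = (\<integral>s. \<integral>a. \<integral>s'. g s' \<partial>P (s, a) \<partial>\<pi> s \<partial>state_dist \<mu> P \<pi> t)"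
  proof (intro Bochner_Integration.integral_cong refl)
    fix s assume "s \<in> space (state_dist \<mu> P \<pi> t)"
    then have s: "s \<in> space S" using space_prob_algebraD(2)[OF state_dist_in] by simp
    show "(\<integral>s'. g s' \<partial>(\<pi> s \<bind> (\<lambda>a. P (s, a)))) = (\<integral>a. \<integral>s'. g s' \<partial>P (s, a) \<partial>\<pi> s)"
      by (rule integral_bind_prob_algebra[OF measurable_space[OF \<pi> s]
            measurable_compose[OF measurable_Pair1'[OF s] P] g b])
  qed
  also have "\<dots> = (\<integral>x. \<integral>s. g s \<partial>P x \<partial>state_action_dist S A \<mu> P \<pi> t)"
    by (rule integral_state_action_dist[symmetric, OF kernel_integral_measurable[OF P g]
          prob_algebra_abs_integral_le[OF measurable_space[OF P] b]])
  finally show ?thesis .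
qed

context
  fixes \<gamma> :: real
  assumes \<gamma>: "0 \<le> \<gamma>" "\<gamma> < 1"
begin

lemma geometric_in: "measure_pmf (geometric_pmf (1 - \<gamma>)) \<in> space (prob_algebra (count_space UNIV))"
  by (simp add: space_prob_algebra measure_pmf.prob_space_axioms)

text \<open>The weights \<open>(1 - \<gamma>) * \<gamma> ^ t\<close> are those of the geometric law
  with parameter \<open>1 - \<gamma>\<close>. The visitation is the law of the state-action pair at
  an independent geometric time, so the facts on kernels apply to it.\<close>

lemma visitation_eq_bind:
  "visitation S A \<mu> P \<gamma> \<pi> = measure_pmf (geometric_pmf (1 - \<gamma>)) \<bind> state_action_dist S A \<mu> P \<pi>"
  (is "_ = ?R")
proof -
  have k: "state_action_dist S A \<mu> P \<pi> \<in> count_space UNIV \<rightarrow>\<^sub>M prob_algebra (S \<Otimes>\<^sub>M A)"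
    using state_action_dist_in by simp
  have "?R \<in> space (prob_algebra (S \<Otimes>\<^sub>M A))"
    by (rule bind_in_prob_algebra[OF geometric_in k])
  note R = space_prob_algebraD[OF this]
  have "emeasure ?R B = ennreal (1 - \<gamma>) *
      (\<Sum>t. ennreal (\<gamma> ^ t) * emeasure (state_action_dist S A \<mu> P \<pi> t) B)"
    if B: "B \<in> sets (S \<Otimes>\<^sub>M A)" for B
  proof -
    have "emeasure ?R B = (\<integral>\<^sup>+t. emeasure (state_action_dist S A \<mu> P \<pi> t) B \<partial>measure_pmf (geometric_pmf (1 - \<gamma>)))"
      by (rule emeasure_bind_prob_algebra[OF geometric_in k B])
    also have "\<dots> = (\<Sum>t. ennreal (pmf (geometric_pmf (1 - \<gamma>)) t) * emeasure (state_action_dist S A \<mu> P \<pi> t) B)"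
      by (simp only: nn_integral_measure_pmf nn_integral_count_space_nat)
    also have "\<dots> = (\<Sum>t. ennreal (1 - \<gamma>) * (ennreal (\<gamma> ^ t) * emeasure (state_action_dist S A \<mu> P \<pi> t) B))"
      using \<gamma> by (intro suminf_cong) (simp add: ennreal_mult mult_ac)
    finally show ?thesis by simp
  qed
  then have "visitation S A \<mu> P \<gamma> \<pi> = measure_of (space (S \<Otimes>\<^sub>M A)) (sets (S \<Otimes>\<^sub>M A)) (emeasure ?R)"
    unfolding visitation_def
    by (intro measure_of_eq sets.space_closed) (simp add: sets.sigma_sets_eq)
  also have "\<dots> = ?R"
    using measure_of_of_measure[of ?R] R(1,2) by simp
  finally show ?thesis .
qed

lemma visitation_in: "visitation S A \<mu> P \<gamma> \<pi> \<in> space (prob_algebra (S \<Otimes>\<^sub>M A))"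
  unfolding visitation_eq_bind
  by (rule bind_in_prob_algebra[OF geometric_in]) (use state_action_dist_in in simp)

text \<open>The integral over the geometric time is written against counting measure, where
  integrability turns it into a convergent series.\<close>

lemma sums_integral_visitation:
  fixes F :: "'s \<times> 'a \<Rightarrow> real"
  assumes F: "F \<in> borel_measurable (S \<Otimes>\<^sub>M A)" and b: "\<And>x. x \<in> space (S \<Otimes>\<^sub>M A) \<Longrightarrow> \<bar>F x\<bar> \<le> B"
  shows "(\<lambda>t. (1 - \<gamma>) * \<gamma> ^ t * (\<integral>x. F x \<partial>state_action_dist S A \<mu> P \<pi> t))
    sums (\<integral>x. F x \<partial>visitation S A \<mu> P \<gamma> \<pi>)"
proof -
  let ?G = "geometric_pmf (1 - \<gamma>)"
  let ?h = "\<lambda>t. \<integral>x. F x \<partial>state_action_dist S A \<mu> P \<pi> t"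
  have eq: "(\<integral>x. F x \<partial>visitation S A \<mu> P \<gamma> \<pi>) = (\<integral>t. ?h t \<partial>measure_pmf ?G)"
    unfolding visitation_eq_bind
    by (rule integral_bind_prob_algebra[OF geometric_in _ F b]) (use state_action_dist_in in auto)
  have "integrable (measure_pmf ?G) ?h"
    by (rule prob_algebra_integrable[OF geometric_in, where B=B])
      (auto intro: prob_algebra_abs_integral_le[OF state_action_dist_in b])
  then have "integrable (count_space UNIV) (\<lambda>t. pmf ?G t * ?h t)"
    unfolding measure_pmf_eq_density by (subst (asm) integrable_density) auto
  from sums_integral_count_space_nat[OF this]
  have "(\<lambda>t. pmf ?G t * ?h t) sums (\<integral>t. ?h t \<partial>measure_pmf ?G)"
    unfolding measure_pmf_eq_density by (subst integral_density) auto
  then show ?thesis using \<gamma> by (simp add: eq mult_ac)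
qed

text \<open>At every time the action is drawn from \<open>\<pi>\<close> given the state, so both
  sides have the same series.\<close>

lemma integral_visitation_policy:
  fixes F :: "'s \<times> 'a \<Rightarrow> real"
  assumes F: "F \<in> borel_measurable (S \<Otimes>\<^sub>M A)" and b: "\<And>x. x \<in> space (S \<Otimes>\<^sub>M A) \<Longrightarrow> \<bar>F x\<bar> \<le> B"
  shows "(\<integral>x. F x \<partial>visitation S A \<mu> P \<gamma> \<pi>) = (\<integral>x. \<integral>a. F (fst x, a) \<partial>\<pi> (fst x) \<partial>visitation S A \<mu> P \<gamma> \<pi>)"
proof -
  define g where "g s = (\<integral>a. F (s, a) \<partial>\<pi> s)" for s
  have g: "g \<in> borel_measurable S" unfolding g_def by (rule kernel_integral_measurable2(1)[OF \<pi> F])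
  have gb: "\<bar>g s\<bar> \<le> B" if "s \<in> space S" for s
    unfolding g_def using that
    by (intro prob_algebra_abs_integral_le[OF measurable_space[OF \<pi> that]] b) (simp add: space_pair_measure)
  have "(\<lambda>x. g (fst x)) \<in> borel_measurable (S \<Otimes>\<^sub>M A)" using g by measurable
  from sums_integral_visitation[OF this, of B] gb
  have "(\<lambda>t. (1 - \<gamma>) * \<gamma> ^ t * (\<integral>x. F x \<partial>state_action_dist S A \<mu> P \<pi> t))
    sums (\<integral>x. g (fst x) \<partial>visitation S A \<mu> P \<gamma> \<pi>)"
    using integral_state_action_dist[OF F b] integral_state_action_dist_fst[OF g gb]
    by (auto simp: g_def space_pair_measure)
  from sums_unique2[OF sums_integral_visitation[OF F b] this] show ?thesis by (simp add: g_def)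
qed

text \<open>The series is shifted by one: the term at \<open>t = 0\<close> gives the initial law,
  and the rest is \<open>\<gamma>\<close> times the series of the next state.\<close>

lemma visitation_flow:
  fixes g :: "'s \<Rightarrow> real"
  assumes g: "g \<in> borel_measurable S" and b: "\<And>s. s \<in> space S \<Longrightarrow> \<bar>g s\<bar> \<le> B"
  shows "(\<integral>x. g (fst x) \<partial>visitation S A \<mu> P \<gamma> \<pi>)
    = (1 - \<gamma>) * (\<integral>s. g s \<partial>\<mu>) + \<gamma> * (\<integral>x. \<integral>s. g s \<partial>P x \<partial>visitation S A \<mu> P \<gamma> \<pi>)"
proof -
  let ?a = "\<lambda>t. \<integral>s. g s \<partial>state_dist \<mu> P \<pi> t"
  have "(\<lambda>x. g (fst x)) \<in> borel_measurable (S \<Otimes>\<^sub>M A)" using g by measurable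
  from sums_integral_visitation[OF this, of B] b
  have 1: "(\<lambda>t. (1 - \<gamma>) * \<gamma> ^ t * ?a t) sums (\<integral>x. g (fst x) \<partial>visitation S A \<mu> P \<gamma> \<pi>)"
    using integral_state_action_dist_fst[OF g b] by (auto simp: space_pair_measure)
  have "(\<lambda>t. (1 - \<gamma>) * \<gamma> ^ t * ?a (Suc t)) sums (\<integral>x. \<integral>s. g s \<partial>P x \<partial>visitation S A \<mu> P \<gamma> \<pi>)"
    using sums_integral_visitation[OF kernel_integral_measurable[OF P g]
        prob_algebra_abs_integral_le[OF measurable_space[OF P] b]]
    by (simp add: integral_state_dist_Suc[OF g b] del: state_dist.simps)
  from sums_mult[OF this, of \<gamma>]
  have "(\<lambda>t. (1 - \<gamma>) * \<gamma> ^ Suc t * ?a (Suc t)) sums (\<gamma> * (\<integral>x. \<integral>s. g s \<partial>P x \<partial>visitation S A \<mu> P \<gamma> \<pi>))"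
    by (simp add: mult_ac)
  from sums_Suc[OF this] have "(\<lambda>t. (1 - \<gamma>) * \<gamma> ^ t * ?a t)
     sums (\<gamma> * (\<integral>x. \<integral>s. g s \<partial>P x \<partial>visitation S A \<mu> P \<gamma> \<pi>) + (1 - \<gamma>) * (\<integral>s. g s \<partial>\<mu>))"
    by simp
  from sums_unique2[OF 1 this] show ?thesis by simp
qed

end

end

section \<open>Policy evaluation and the difference of returns\<close>

text \<open>Iterates of the Bellman operator of \<open>\<pi>\<close> started at 0, that is, the
  expected discounted sum of the first \<open>n\<close> rewards. Finite iterates suffice because the
  error is removed by a limit at the end.\<close>

primrec value_iter ::
  "('s \<times> 'a \<Rightarrow> 's measure) \<Rightarrow> ('s \<times> 'a \<Rightarrow> real) \<Rightarrow> real \<Rightarrow> ('s \<Rightarrow> 'a measure) \<Rightarrow> nat \<Rightarrow> 's \<Rightarrow> real" where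
  "value_iter P r \<gamma> \<pi> 0 = (\<lambda>s. 0)"
| "value_iter P r \<gamma> \<pi> (Suc n) =
     (\<lambda>s. \<integral>a. r (s, a) + \<gamma> * (\<integral>s'. value_iter P r \<gamma> \<pi> n s' \<partial>P (s, a)) \<partial>\<pi> s)"

context
  fixes S :: "'s measure" and A :: "'a measure"
    and P :: "'s \<times> 'a \<Rightarrow> 's measure" and \<pi> :: "'s \<Rightarrow> 'a measure"
    and r :: "'s \<times> 'a \<Rightarrow> real" and \<gamma> R :: real
  assumes P: "P \<in> S \<Otimes>\<^sub>M A \<rightarrow>\<^sub>M prob_algebra S"
    and \<pi>: "\<pi> \<in> S \<rightarrow>\<^sub>M prob_algebra A"
    and r: "r \<in> borel_measurable (S \<Otimes>\<^sub>M A)"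
    and R: "\<And>x. x \<in> space (S \<Otimes>\<^sub>M A) \<Longrightarrow> \<bar>r x\<bar> \<le> R" "0 \<le> R"
    and \<gamma>: "0 \<le> \<gamma>" "\<gamma> < 1"
begin

private abbreviation "V \<equiv> value_iter P r \<gamma> \<pi>"
private abbreviation "Q n x \<equiv> r x + \<gamma> * (\<integral>s'. V n s' \<partial>P x)"

lemma value_iter_measurable: "V n \<in> borel_measurable S"
proof (induction n)
  case (Suc n)
  have "(\<lambda>x. Q n x) \<in> borel_measurable (S \<Otimes>\<^sub>M A)"
    using kernel_integral_measurable[OF P Suc] r by measurable
  from kernel_integral_measurable2(1)[OF \<pi> this] show ?case by simp
qed simp

lemma Q_measurable: "(\<lambda>x. Q n x) \<in> borel_measurable (S \<Otimes>\<^sub>M A)"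
  using kernel_integral_measurable[OF P value_iter_measurable] r by measurable

text \<open>\<open>R / (1 - \<gamma>)\<close> solves \<open>b = R + \<gamma> * b\<close>, which
  closes the induction. The bound on \<open>Q n\<close> is its intermediate step, so the two are
  proved together.\<close>

lemma value_iter_bound: "s \<in> space S \<Longrightarrow> \<bar>V n s\<bar> \<le> R / (1 - \<gamma>)"
  and Q_bound: "x \<in> space (S \<Otimes>\<^sub>M A) \<Longrightarrow> \<bar>Q n x\<bar> \<le> R / (1 - \<gamma>)"
proof -
  have Q: "\<bar>Q n x\<bar> \<le> R / (1 - \<gamma>)"
    if "x \<in> space (S \<Otimes>\<^sub>M A)" "\<And>s. s \<in> space S \<Longrightarrow> \<bar>V n s\<bar> \<le> R / (1 - \<gamma>)" for n x
  proof -
    have "\<bar>\<integral>s'. V n s' \<partial>P x\<bar> \<le> R / (1 - \<gamma>)"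
      by (rule prob_algebra_abs_integral_le[OF measurable_space[OF P that(1)] that(2)])
    then have "\<bar>\<gamma> * (\<integral>s'. V n s' \<partial>P x)\<bar> \<le> \<gamma> * (R / (1 - \<gamma>))"
      using \<gamma> by (simp add: abs_mult mult_left_mono del: times_divide_eq_right)
    then have "\<bar>Q n x\<bar> \<le> R + \<gamma> * (R / (1 - \<gamma>))"
      using R(1)[OF that(1)] by linarith
    also have "\<dots> = R / (1 - \<gamma>)" using \<gamma> by (simp add: field_simps)
    finally show ?thesis .
  qed
  have V: "s \<in> space S \<Longrightarrow> \<bar>V n s\<bar> \<le> R / (1 - \<gamma>)" for n s
  proof (induction n arbitrary: s)
    case 0
    then show ?case using R \<gamma> by simp
  next
    case (Suc n)
    show ?case
      unfolding value_iter.simps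
      by (rule prob_algebra_abs_integral_le[OF measurable_space[OF \<pi> Suc.prems]], rule Q)
        (use Suc in \<open>auto simp: space_pair_measure\<close>)
  qed
  show "s \<in> space S \<Longrightarrow> \<bar>V n s\<bar> \<le> R / (1 - \<gamma>)" by (rule V)
  show "x \<in> space (S \<Otimes>\<^sub>M A) \<Longrightarrow> \<bar>Q n x\<bar> \<le> R / (1 - \<gamma>)" by (rule Q[OF _ V])
qed

text \<open>The Bellman operator contracts by \<open>\<gamma>\<close>, since the reward cancels in
  the difference. The first difference is a mean reward, at most \<open>R\<close> in absolute
  value.\<close>

lemma value_iter_diff: "s \<in> space S \<Longrightarrow> \<bar>V (Suc n) s - V n s\<bar> \<le> \<gamma> ^ n * R"
proof (induction n arbitrary: s)
  case 0
  show ?case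
    using prob_algebra_abs_integral_le[OF measurable_space[OF \<pi> 0], of "\<lambda>a. r (s, a)" R] R(1) 0
    by (auto simp: space_pair_measure)
next
  case (Suc n)
  note ps = measurable_space[OF \<pi> Suc.prems]
  have sa: "(s, a) \<in> space (S \<Otimes>\<^sub>M A)" if "a \<in> space A" for a
    using that Suc.prems by (simp add: space_pair_measure)
  have Qi: "integrable (\<pi> s) (\<lambda>a. Q n (s, a))" for n
    by (rule prob_algebra_integrable[OF ps measurable_compose[OF measurable_Pair1'[OF Suc.prems] Q_measurable]])
      (rule Q_bound[OF sa])
  have Vi: "integrable (P x) (V n)" if "x \<in> space (S \<Otimes>\<^sub>M A)" for n x
    by (rule prob_algebra_integrable[OF measurable_space[OF P that] value_iter_measurable value_iter_bound])
  have "V (Suc (Suc n)) s - V (Suc n) s = (\<integral>a. Q (Suc n) (s, a) - Q n (s, a) \<partial>\<pi> s)"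
    using Bochner_Integration.integral_diff[OF Qi[of "Suc n"] Qi[of n]] by simp
  moreover have "\<bar>\<integral>a. Q (Suc n) (s, a) - Q n (s, a) \<partial>\<pi> s\<bar> \<le> \<gamma> ^ Suc n * R"
  proof (rule prob_algebra_abs_integral_le[OF ps])
    fix a assume a: "a \<in> space A"
    have "Q (Suc n) (s, a) - Q n (s, a) = \<gamma> * (\<integral>s'. V (Suc n) s' - V n s' \<partial>P (s, a))"
      using Bochner_Integration.integral_diff[OF Vi[OF sa[OF a], of "Suc n"] Vi[OF sa[OF a], of n]]
      by (simp only: right_diff_distrib)
    also have "\<bar>\<dots>\<bar> \<le> \<gamma> * (\<gamma> ^ n * R)"
      using prob_algebra_abs_integral_le[OF measurable_space[OF P sa[OF a]] Suc.IH] \<gamma>(1)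
      unfolding abs_mult by (simp add: mult_left_mono del: value_iter.simps)
    finally show "\<bar>Q (Suc n) (s, a) - Q n (s, a)\<bar> \<le> \<gamma> ^ Suc n * R" by (simp add: mult_ac)
  qed
  ultimately show ?case by simp
qed

text \<open>An approximate performance-difference identity: \<open>P'\<close> drives the visitation
  and \<open>P\<close> the values. Bellman's equation expresses the mean of
  \<open>V (Suc n)\<close>, the flow equation that of \<open>V n\<close>; after subtraction only the
  mean of \<open>V (Suc n) - V n\<close> remains as the error.\<close>

lemma return_decomposition:
  assumes \<mu>: "\<mu> \<in> space (prob_algebra S)" and P': "P' \<in> S \<Otimes>\<^sub>M A \<rightarrow>\<^sub>M prob_algebra S"
  defines "\<rho> \<equiv> visitation S A \<mu> P' \<gamma> \<pi>"
  shows "\<bar>(\<integral>x. r x \<partial>\<rho>) - ((1 - \<gamma>) * (\<integral>s. V n s \<partial>\<mu>)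
    + \<gamma> * (\<integral>x. (\<integral>s. V n s \<partial>P' x) - (\<integral>s. V n s \<partial>P x) \<partial>\<rho>))\<bar> \<le> \<gamma> ^ n * R"
proof -
  let ?X = "S \<Otimes>\<^sub>M A"
  have \<rho>: "\<rho> \<in> space (prob_algebra ?X)"
    unfolding \<rho>_def by (rule visitation_in[OF \<mu> P' \<pi> \<gamma>])
  have Pi: "integrable \<rho> (\<lambda>x. \<integral>s. V n s \<partial>N x)" if "N \<in> ?X \<rightarrow>\<^sub>M prob_algebra S" for N
    by (rule prob_algebra_integrable[OF \<rho> kernel_integral_measurable[OF that value_iter_measurable]
          prob_algebra_abs_integral_le[OF measurable_space[OF that] value_iter_bound]])
  have ri: "integrable \<rho> r" by (rule prob_algebra_integrable[OF \<rho> r R(1)])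
  have Vi: "integrable \<rho> (\<lambda>x. V m (fst x))" for m
  proof (rule prob_algebra_integrable[OF \<rho>])
    show "(\<lambda>x. V m (fst x)) \<in> borel_measurable ?X"
      by (rule measurable_compose[OF measurable_fst value_iter_measurable])
    show "\<bar>V m (fst x)\<bar> \<le> R / (1 - \<gamma>)" if "x \<in> space ?X" for x
      using that by (intro value_iter_bound) (auto simp: space_pair_measure)
  qed
  have "(\<integral>x. V (Suc n) (fst x) \<partial>\<rho>) = (\<integral>x. Q n x \<partial>\<rho>)"
    unfolding value_iter.simps \<rho>_def
    by (rule integral_visitation_policy[OF \<mu> P' \<pi> \<gamma> Q_measurable Q_bound, symmetric])
  also have "\<dots> = (\<integral>x. r x \<partial>\<rho>) + \<gamma> * (\<integral>x. \<integral>s. V n s \<partial>P x \<partial>\<rho>)"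
    using ri Pi[OF P] by simp
  finally have 1: "(\<integral>x. V (Suc n) (fst x) \<partial>\<rho>) = (\<integral>x. r x \<partial>\<rho>) + \<gamma> * (\<integral>x. \<integral>s. V n s \<partial>P x \<partial>\<rho>)" .
  have 2: "(\<integral>x. V n (fst x) \<partial>\<rho>) = (1 - \<gamma>) * (\<integral>s. V n s \<partial>\<mu>) + \<gamma> * (\<integral>x. \<integral>s. V n s \<partial>P' x \<partial>\<rho>)"
    unfolding \<rho>_def by (rule visitation_flow[OF \<mu> P' \<pi> \<gamma> value_iter_measurable value_iter_bound])
  have "\<bar>\<integral>x. V (Suc n) (fst x) - V n (fst x) \<partial>\<rho>\<bar> \<le> \<gamma> ^ n * R"
    by (rule prob_algebra_abs_integral_le[OF \<rho> value_iter_diff]) (auto simp: space_pair_measure)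
  then have 3: "\<bar>(\<integral>x. V (Suc n) (fst x) \<partial>\<rho>) - (\<integral>x. V n (fst x) \<partial>\<rho>)\<bar> \<le> \<gamma> ^ n * R"
    unfolding Bochner_Integration.integral_diff[OF Vi Vi] .
  show ?thesis
    unfolding Bochner_Integration.integral_diff[OF Pi[OF P'] Pi[OF P]] right_diff_distrib
    using 1 2 3 by linarith
qed

end

section \<open>Lower integrals and the bound on the returns\<close>

text \<open>\<open>h\<close> need not be measurable, so the constant is moved to the side of \<open>g\<close>.\<close>

lemma integral_le_lower_integral:
  fixes g :: "'x \<Rightarrow> real"
  assumes g: "integrable M g" and c: "c > 0"
    and h: "\<And>x. x \<in> space M \<Longrightarrow> ennreal (g x) \<le> ennreal c * h x"
    and i: "(\<integral>\<^sup>+x. h x \<partial>M) = ennreal i" "0 \<le> i"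
  shows "(\<integral>x. g x \<partial>M) \<le> c * i"
proof -
  have gi: "integrable M (\<lambda>x. max 0 (g x / c))" using g by auto
  have le: "ennreal (max 0 (g x / c)) \<le> h x" if "x \<in> space M" for x
  proof (cases "h x = \<top>")
    case False
    then obtain y where y: "h x = ennreal y" "0 \<le> y" by (cases "h x") auto
    have "ennreal (g x) \<le> ennreal (c * y)"
      using h[OF that] c y by (simp add: ennreal_mult)
    moreover have "0 \<le> c * y" using c y by simp
    ultimately have "g x \<le> c * y" using ennreal_le_iff by blast
    then show ?thesis using c y by (auto simp: field_simps intro!: ennreal_leI)
  qed simp
  have "ennreal (\<integral>x. max 0 (g x / c) \<partial>M) = (\<integral>\<^sup>+x. ennreal (max 0 (g x / c)) \<partial>M)"
    using gi by (intro nn_integral_eq_integral[symmetric]) auto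
  also have "\<dots> \<le> ennreal i"
    unfolding i(1)[symmetric] by (rule nn_integral_mono[OF le])
  finally have "(\<integral>x. max 0 (g x / c) \<partial>M) \<le> i" using i(2) by simp
  moreover have "(\<integral>x. g x / c \<partial>M) \<le> (\<integral>x. max 0 (g x / c) \<partial>M)"
    using g gi by (intro integral_mono) auto
  ultimately have "(\<integral>x. g x \<partial>M) / c \<le> i" by simp
  then show ?thesis using c by (simp add: field_simps)
qed

theorem mainTheorem1:
  fixes S :: "'s measure" and A :: "'a measure" and \<mu> :: "'s measure"
    and P_src P_tar :: "'s \<times> 'a \<Rightarrow> 's measure"
    and r :: "'s \<times> 'a \<Rightarrow> real" and \<gamma> r_max :: real
    and K :: nat and Z :: "nat \<Rightarrow> 's measure"
    and \<nu>_src \<nu>_tar :: "'s \<times> 'a \<Rightarrow> 's measure"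
    and T_src T_tar :: "nat \<Rightarrow> 's \<times> ('s \<times> 'a) \<Rightarrow> 's measure"
    and \<pi> :: "'s \<Rightarrow> 'a measure"
  assumes "is_mdp S A \<mu> P_src r \<gamma>" and "is_mdp S A \<mu> P_tar r \<gamma>"
    and "\<forall>s\<in>space S. \<forall>a\<in>space A. \<bar>r (s, a)\<bar> \<le> r_max"
    and "K \<ge> 1"
    and "is_generative_trajectory S A Z K P_src \<nu>_src T_src"
    and "is_generative_trajectory S A Z K P_tar \<nu>_tar T_tar"
    and "is_policy S A \<pi>"
  shows "ereal (expected_return S A \<mu> P_src r \<gamma> \<pi> - expected_return S A \<mu> P_tar r \<gamma> \<pi>)
    \<le> ereal (sqrt 2 * \<gamma> * r_max / (1 - \<gamma>)\<^sup>2) *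
        enn2ereal (\<integral>\<^sup>+x. ennreal_sqrt
          (\<integral>\<^sup>+\<omega>. KL_div (\<nu>_src x) (\<nu>_tar x) \<partial>trajectory Z K \<nu>_src T_src x)
          \<partial>visitation S A \<mu> P_src \<gamma> \<pi>)
      + ereal (sqrt 2 * \<gamma> * r_max / (1 - \<gamma>)\<^sup>2) *
        enn2ereal (\<integral>\<^sup>+x. ennreal_sqrt
          (\<integral>\<^sup>+\<omega>. (\<Sum>k = 1..K. KL_div (T_src k (\<omega> k, x)) (T_tar k (\<omega> k, x)))
             \<partial>trajectory Z K \<nu>_src T_src x)
          \<partial>visitation S A \<mu> P_src \<gamma> \<pi>)"
proof -
  let ?X = "S \<Otimes>\<^sub>M A"
  define \<rho> where "\<rho> = visitation S A \<mu> P_src \<gamma> \<pi>"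
  define h1 where "h1 x = ennreal_sqrt (\<integral>\<^sup>+\<omega>. KL_div (\<nu>_src x) (\<nu>_tar x) \<partial>trajectory Z K \<nu>_src T_src x)" for x
  define h2 where "h2 x = ennreal_sqrt (\<integral>\<^sup>+\<omega>. (\<Sum>k = 1..K. KL_div (T_src k (\<omega> k, x)) (T_tar k (\<omega> k, x)))
             \<partial>trajectory Z K \<nu>_src T_src x)" for x
  define c0 where "c0 = sqrt 2 * \<gamma> * r_max / (1 - \<gamma>)\<^sup>2"
  define C where "C = r_max / (1 - \<gamma>)"
  define d where "d = expected_return S A \<mu> P_src r \<gamma> \<pi> - expected_return S A \<mu> P_tar r \<gamma> \<pi>"
  have \<mu>: "\<mu> \<in> space (prob_algebra S)" and Ps: "P_src \<in> ?X \<rightarrow>\<^sub>M prob_algebra S"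
    and Pt: "P_tar \<in> ?X \<rightarrow>\<^sub>M prob_algebra S" and rm: "r \<in> borel_measurable ?X"
    and \<gamma>: "0 \<le> \<gamma>" "\<gamma> < 1"
    using assms(1,2) by (auto simp: is_mdp_def)
  have \<pi>: "\<pi> \<in> S \<rightarrow>\<^sub>M prob_algebra A" using assms(7) by (simp add: is_policy_def)
  have rb: "\<bar>r x\<bar> \<le> r_max" if "x \<in> space ?X" for x
    using assms(3) that by (auto simp: space_pair_measure)
  have \<rho>: "\<rho> \<in> space (prob_algebra ?X)"
    unfolding \<rho>_def by (rule visitation_in[OF \<mu> Ps \<pi> \<gamma>])
  have sp\<rho>: "space \<rho> = space ?X" by (rule space_prob_algebraD(2)[OF \<rho>])
  \<comment> \<open>The visitation is a probability measure, so its space has a point, and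
    \<open>r_max\<close> dominates an absolute value there.\<close>
  obtain x0 where "x0 \<in> space ?X"
    using prob_space.not_empty[OF space_prob_algebraD(3)[OF \<rho>]] sp\<rho> by auto
  then have R0: "0 \<le> r_max" using rb[of x0] by linarith
  define V where "V = value_iter P_tar r \<gamma> \<pi>"
  define gap where "gap n x = (\<integral>s. V n s \<partial>P_src x) - (\<integral>s. V n s \<partial>P_tar x)" for n x
  have Vm: "V n \<in> borel_measurable S" for n
    unfolding V_def by (rule value_iter_measurable[OF Pt \<pi> rm rb R0 \<gamma>])
  have Vb: "\<bar>V n s\<bar> \<le> C" if "s \<in> space S" for n s
    unfolding V_def C_def by (rule value_iter_bound[OF Pt \<pi> rm rb R0 \<gamma> that])
  have gm: "gap n \<in> borel_measurable ?X" for n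
    unfolding gap_def using kernel_integral_measurable[OF Ps Vm] kernel_integral_measurable[OF Pt Vm]
    by (rule borel_measurable_diff)
  have gb: "\<bar>gap n x\<bar> \<le> 2 * C" if "x \<in> space ?X" for n x
  proof -
    have "\<bar>\<integral>s. V n s \<partial>P_src x\<bar> \<le> C"
      by (rule prob_algebra_abs_integral_le[OF measurable_space[OF Ps that] Vb])
    moreover have "\<bar>\<integral>s. V n s \<partial>P_tar x\<bar> \<le> C"
      by (rule prob_algebra_abs_integral_le[OF measurable_space[OF Pt that] Vb])
    ultimately show ?thesis unfolding gap_def by linarith
  qed
  \<comment> \<open>The target values are decomposed against both visitations. The initial terms
    agree and cancel, the correction vanishes for the target visitation, and the two errors add
    up.\<close>
  have d_le: "d \<le> \<gamma> * (\<integral>x. gap n x \<partial>\<rho>) + 2 * \<gamma> ^ n * r_max" for n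
    using return_decomposition[OF Pt \<pi> rm rb R0 \<gamma> \<mu> Ps, of n]
      return_decomposition[OF Pt \<pi> rm rb R0 \<gamma> \<mu> Pt, of n]
    unfolding d_def expected_return_def gap_def V_def \<rho>_def by simp
  have *: "ereal d \<le> ereal c0 * enn2ereal (\<integral>\<^sup>+x. h1 x \<partial>\<rho>) + ereal c0 * enn2ereal (\<integral>\<^sup>+x. h2 x \<partial>\<rho>)"
  \<comment> \<open>Here the constant \<open>c0\<close> is 0, and so is the right-hand side, as
    \<open>0 * \<infinity> = 0\<close> in \<open>ereal\<close>; thus \<open>d \<le> 0\<close> must
    be shown directly. For \<open>\<gamma> = 0\<close> the choice \<open>n = 1\<close> removes the
    error, which \<open>n = 0\<close> would not since \<open>0 ^ 0 = 1\<close>.\<close>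
  proof (cases "\<gamma> = 0 \<or> r_max = 0")
    case True
    have "d \<le> 0"
    proof (cases "\<gamma> = 0")
      case True
      then show ?thesis using d_le[of 1] by simp
    next
      case False
      with True have "r_max = 0" by simp
      moreover have "\<bar>\<integral>x. gap 0 x \<partial>\<rho>\<bar> \<le> 2 * C" by (rule prob_algebra_abs_integral_le[OF \<rho> gb])
      ultimately show ?thesis using d_le[of 0] by (simp add: C_def)
    qed
    moreover have "c0 = 0" using True by (auto simp: c0_def)
    ultimately show ?thesis by (simp flip: zero_ereal_def)
  next
    case False
    then have pos: "0 < \<gamma>" "0 < r_max" using \<gamma> R0 by auto
    have C: "C > 0" using pos \<gamma> by (simp add: C_def)
    have c0: "c0 > 0" using pos \<gamma> by (simp add: c0_def)
    show ?thesis
    proof (cases "(\<integral>\<^sup>+x. h1 x \<partial>\<rho>) = \<top> \<or> (\<integral>\<^sup>+x. h2 x \<partial>\<rho>) = \<top>")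
      case True
      then show ?thesis using c0 by (auto simp: top_ereal_def)
    next
      case False
      then obtain i1 i2 where i: "(\<integral>\<^sup>+x. h1 x \<partial>\<rho>) = ennreal i1" "0 \<le> i1" "(\<integral>\<^sup>+x. h2 x \<partial>\<rho>) = ennreal i2" "0 \<le> i2"
        by (metis ennreal_cases)
      have gap_le: "(\<integral>x. gap n x \<partial>\<rho>) \<le> sqrt 2 * C * (i1 + i2)" for n
      proof -
        obtain g1 g2 where g: "g1 \<in> borel_measurable ?X"
          "\<And>x. x \<in> space ?X \<Longrightarrow> \<bar>g1 x\<bar> \<le> 2 * C"
          "\<And>x. x \<in> space ?X \<Longrightarrow> gap n x = g1 x + g2 x"
          "\<And>x. x \<in> space ?X \<Longrightarrow> ennreal (g1 x) \<le> ennreal (sqrt 2 * C) * h1 x"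
          "\<And>x. x \<in> space ?X \<Longrightarrow> ennreal (g2 x) \<le> ennreal (sqrt 2 * C) * h2 x"
          using generative_trajectory_gap[OF assms(5,6) Vm[of n] Vb C]
          unfolding gap_def h1_def h2_def by blast
        have i1: "integrable \<rho> g1" by (rule prob_algebra_integrable[OF \<rho> g(1,2)])
        have ig: "integrable \<rho> (gap n)" by (rule prob_algebra_integrable[OF \<rho> gm gb])
        \<comment> \<open>\<open>g2\<close> agrees on the space with the gap minus
          \<open>g1\<close>, both of which are bounded and measurable.\<close>
        have i2: "integrable \<rho> g2"
          using Bochner_Integration.integrable_diff[OF ig i1] g(3) sp\<rho>
          by (subst Bochner_Integration.integrable_cong[OF refl, of _ _ "\<lambda>x. gap n x - g1 x"]) auto
        have "(\<integral>x. gap n x \<partial>\<rho>) = (\<integral>x. g1 x + g2 x \<partial>\<rho>)"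
          using g(3) sp\<rho> by (intro Bochner_Integration.integral_cong) auto
        also have "\<dots> = (\<integral>x. g1 x \<partial>\<rho>) + (\<integral>x. g2 x \<partial>\<rho>)" using i1 i2 by simp
        also have "(\<integral>x. g1 x \<partial>\<rho>) \<le> sqrt 2 * C * i1"
          using C g(4) i by (intro integral_le_lower_integral[OF i1]) (auto simp: sp\<rho>)
        also have "(\<integral>x. g2 x \<partial>\<rho>) \<le> sqrt 2 * C * i2"
          using C g(5) i by (intro integral_le_lower_integral[OF i2]) (auto simp: sp\<rho>)
        finally show ?thesis by (simp add: distrib_left)
      qed
      have "d \<le> \<gamma> * (sqrt 2 * C * (i1 + i2)) + 2 * \<gamma> ^ n * r_max" for n
        using d_le[of n] mult_left_mono[OF gap_le[of n] \<gamma>(1)] by linarith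
      \<comment> \<open>The main term does not depend on \<open>n\<close>, although the split into
        \<open>g1\<close> and \<open>g2\<close> does; letting \<open>n\<close> tend to infinity
        removes the error.\<close>
      moreover have "(\<lambda>n. \<gamma> * (sqrt 2 * C * (i1 + i2)) + 2 * \<gamma> ^ n * r_max)
          \<longlonglongrightarrow> \<gamma> * (sqrt 2 * C * (i1 + i2)) + 2 * 0 * r_max"
        using \<gamma> by (intro tendsto_intros LIMSEQ_realpow_zero) auto
      ultimately have "d \<le> \<gamma> * (sqrt 2 * C * (i1 + i2))"
        by (intro LIMSEQ_le_const[where a=d]) auto
      \<comment> \<open>The constant reached so far is \<open>\<gamma> * sqrt 2 * C\<close>, that is
        \<open>c0 * (1 - \<gamma>)\<close>; the stated one follows from
        \<open>1 - \<gamma> \<le> 1\<close>.\<close>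
      also have "\<dots> = c0 * (1 - \<gamma>) * (i1 + i2)"
        using \<gamma> by (simp add: c0_def C_def power2_eq_square)
      also have "\<dots> \<le> c0 * 1 * (i1 + i2)"
        using c0 \<gamma> i by (intro mult_right_mono mult_left_mono) auto
      finally show ?thesis using i by (simp add: enn2ereal_ennreal distrib_left)
    qed
  qed
  then show ?thesis unfolding d_def c0_def h1_def h2_def \<rho>_def .
qed

end
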